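(* Let $\mathbf{k}$ be a commutative ring, $E_\bullet$ a standard quotient flag over $\mathbf{k}$, and $k\ge1$. If the diagram $D$ has a descent at $k$, then there is an isomorphism of $B$-modules $$\ker\bigl(\mathsf{R}_{k+1}E_\bullet^D\to\mathsf{R}_kE_\bullet^D\bigr)\;\cong\;K_k\otimes\mathsf{R}_{k+1}E_\bullet^{s_kD},$$ where $K_k=\ker\bigl((\mathsf{R}_{k+1}E_\bullet)_k\to(\mathsf{R}_kE_\bullet)_k\bigr)=\ker(E_k\to E_{k-1})$.
   Context: Diagrams. A diagram is a finite tuple $D=[a^{(1)},\dots,a^{(m)}]$ of finite subsets of $\mathbb{Z}_{>0}$ (its columns); a box $(i,j)$ (row $i$, column $j$) belongs to $D$ iff $i\in a^{(j)}$. Reordering columns and adding or deleting empty columns is immaterial. A column $a$ is $k$-full if $k\in a$ implies $k+1\in a$. $D$ has a descent at $k$ if, possibly after reordering columns, there is a column $a^{(j)}$ whose largest element is $k$, such that all columns $a^{(j')}$ with $j'<j$ are $k$-full, and all columns with $j'>j$ satisfy $a^{(j')}\cap\{1,\dots,k+1\}\subseteq a^{(j)}$. The witnessing column is unique up to repetition; take the leftmost one. Then $s_kD$ is the diagram obtained by deleting the box $(k,j)$ of the witnessing column and then swapping rows $k$ and $k+1$. Standard flag. Let $n$ be large enough that all boxes of $D$ and $s_kD$ are in rows $1,\dots,n$. $E$ is a free $\mathbf{k}$-module with basis $z_1,\dots,z_n$ and $E_i=E/\langle z_{i+1},\dots,z_n\rangle$ for $0\le i\le n$, so $E_\bullet$: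 $E=E_n\to\cdots\to E_1\to E_0=0$. Flagged Schur modules. Let $F_\bullet=(F_n\to\cdots\to F_1)$ be any flag of quotients of $E$. Put $TE^D=\bigwedge^{r_1}E\otimes\cdots\otimes\bigwedge^{r_m}E$ with $r_j=|a^{(j)}|$; it has basis $z_\tau=\bigotimes_j z_{b^{(j)}_1}\wedge\cdots\wedge z_{b^{(j)}_{r_j}}$, where $\tau=(b^{(1)},\dots,b^{(m)})$, $b^{(j)}=\{b^{(j)}_1<\dots<b^{(j)}_{r_j}\}\subseteq\{1,\dots,n\}$. The $D$-exchange relations are the elements of the kernel of $TE^D\to\mathbf{k}[z_{pq}]_{1\le p,q\le n}$, $z_\tau\mapsto\prod_j\Delta_{a^{(j)},b^{(j)}}$, where $\Delta_{a,b}$ is the minor of the generic matrix $(z_{pq})$ on rows $a$ and columns $b$. For $a=\{a_1<\dots<a_r\}$, let $F_\bullet^a$ be the quotient of $\bigwedge^rE$ by the sum over $0\le i<r$ of the images of $\bigwedge^iE\otimes\bigwedge^{r-i}\ker(E\to F_{a_{i+1}})$; put $TF_\bullet^D=\bigotimes_jF_\bullet^{a^{(j)}}$. The flagged Schur module $F_\bullet^D$ is the quotient of $TF_\bullet^D$ by the image of the $D$-exchange relations. It is functorial in $F_\bullet$. When $F_\bullet$ is $E_\bullet$ or one of the flags $\mathsf{R}_kE_\bullet$ below, the paper regards $F_\bullet^D$ as a submodule of a polynomial ring via $z_\tau\mapsto\prod_j\Delta_{a^{(j)},b^{(j)}}$, the minors being taken in the generic matrix in which $z_{pq}$ is set to $0$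 whenever $z_q$ maps to $0$ in $F_p$. Bergeron–Sottile operators on flags: $\mathsf{R}_kE_\bullet$ is the flag with $(\mathsf{R}_kE_\bullet)_i=E_i$ for $i<k$ and $(\mathsf{R}_kE_\bullet)_i=E_{i-1}$ for $i\ge k$. The notation $\mathsf{R}_kE_\bullet^D$ means $(\mathsf{R}_kE_\bullet)^D$. The map $\mathsf{R}_{k+1}E_\bullet^D\to\mathsf{R}_kE_\bullet^D$ is induced by the surjection of flags given by $E_k\to E_{k-1}$ in position $k$ and the identity elsewhere. $B\subset GL(E)$ is the group of lower-triangular matrices (those $g$ with $gz_j\in\langle z_j,\dots,z_n\rangle$), i.e. the subgroup preserving $E_\bullet$; it acts on all the modules above by functoriality.
   Formalization: Assumes that the quotient modules R_{k+1}E^D and R_{k+1}E^{s_kD} really embed in the polynomial ring via flagged minors; this convention can fail, and without it the claim is false, e.g. for D=[{2,4},{2,3}], k=3, n=4 (kernel rank 6, right side rank 5). *)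

theory Defs
  imports
    "HOL-Library.Function_Algebras"
    "HOL-Library.Set_Algebras"
    "HOL-Library.Poly_Mapping"
    "HOL-Library.Multiset"
    "HOL-Combinatorics.Transposition"
    "Jordan_Normal_Form.Determinant"
begin

section \<open>Diagrams, descents\<close>

text \<open>A diagram is the list of its columns; the box in row \<open>i\<close> and column \<open>j\<close> belongs to \<open>D\<close>
  iff \<open>i \<in> D ! j\<close>.\<close>

type_synonym diagram = "nat set list"

definition in_rows :: "nat \<Rightarrow> diagram \<Rightarrow> bool" where
  "in_rows n D \<longleftrightarrow> (\<forall>a\<in>set D. a \<subseteq> {1..n})"

definition full_at :: "nat \<Rightarrow> nat set \<Rightarrow> bool" where
  "full_at k a \<longleftrightarrow> (k \<in> a \<longrightarrow> k + 1 \<in> a)"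

text \<open>\<open>D'\<close> is the reordering of the columns of \<open>D\<close>.\<close>

definition descent_witness :: "nat \<Rightarrow> diagram \<Rightarrow> nat set \<Rightarrow> bool" where
  "descent_witness k D a \<longleftrightarrow>
     (\<exists>D' j. mset D' = mset D \<and> j < length D' \<and> D' ! j = a \<and>
        a \<noteq> {} \<and> Max a = k \<and>
        (\<forall>j'<j. full_at k (D' ! j')) \<and>
        (\<forall>j'. j < j' \<and> j' < length D' \<longrightarrow> D' ! j' \<inter> {1..k + 1} \<subseteq> a))"

definition has_descent :: "nat \<Rightarrow> diagram \<Rightarrow> bool" where
  "has_descent k D \<longleftrightarrow> (\<exists>a. descent_witness k D a)"

lemma descent_witness_unique:
  assumes "in_rows n D" and a: "descent_witness k D a" and b: "descent_witness k D b"
  shows "a = b"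
proof -
  have sub: "c \<subseteq> d"
    if c: "descent_witness k D c" and d: "descent_witness k D d" for c d
  proof -
    have cD: "c \<in> set D" "c \<noteq> {}" "Max c = k"
      using c unfolding descent_witness_def by (metis nth_mem mset_eq_setD)+
    have cn: "c \<subseteq> {1..n}" using cD(1) assms(1) by (auto simp: in_rows_def)
    have fin: "finite c" by (rule finite_subset[OF cn]) simp
    have ck: "c \<subseteq> {1..k}" using cn fin cD(3) by (force dest: Max_ge)
    have kc: "k \<in> c" using fin cD by (metis Max_in)
    have nf: "\<not> full_at k c" using kc ck by (auto simp: full_at_def)
    obtain D' j where D': "mset D' = mset D" "j < length D'" "D' ! j = d"
      "\<forall>j'<j. full_at k (D' ! j')"
      "\<forall>j'. j < j' \<and> j' < length D' \<longrightarrow> D' ! j' \<inter> {1..k + 1} \<subseteq> d"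
      using d unfolding descent_witness_def by blast
    obtain i where i: "i < length D'" "D' ! i = c"
      using cD(1) D'(1) by (metis in_set_conv_nth mset_eq_setD)
    then consider "i = j" | "i > j" using D'(4) nf by (metis linorder_neqE_nat)
    then show ?thesis
    proof cases
      case 1 then show ?thesis using i D'(3) by simp
    next
      case 2 then have "c \<inter> {1..k + 1} \<subseteq> d" using D'(5) i by blast
      then show ?thesis using ck by force
    qed
  qed
  show ?thesis using sub[OF a b] sub[OF b a] by blast
qed

text \<open>\<open>s\<^sub>k D\<close>; only meaningful if \<open>D\<close> has a descent at \<open>k\<close>.\<close>

definition descent_op :: "nat \<Rightarrow> diagram \<Rightarrow> diagram" where
  "descent_op k D =
     (let a = (THE a. descent_witness k D a);
          j = (LEAST j. j < length D \<and> D ! j = a)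
      in map (\<lambda>c. Transposition.transpose k (k + 1) ` c) (D[j := a - {k}]))"

section \<open>Modules with an action\<close>

text \<open>Ambient modules are function spaces over the ring \<open>'k\<close> with pointwise operations.\<close>

definition fscale :: "'k::comm_ring_1 \<Rightarrow> ('x \<Rightarrow> 'k) \<Rightarrow> 'x \<Rightarrow> 'k" where
  "fscale c f = (\<lambda>x. c * f x)"

interpretation fscale: Modules.module "fscale :: 'k::comm_ring_1 \<Rightarrow> ('x \<Rightarrow> 'k) \<Rightarrow> 'x \<Rightarrow> 'k"
  by unfold_locales (auto simp: fscale_def fun_eq_iff algebra_simps)

definition basis_vec :: "'x \<Rightarrow> 'x \<Rightarrow> 'k::comm_ring_1" where
  "basis_vec x = (\<lambda>y. if y = x then 1 else 0)"

record ('g, 'k, 'v) rep =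
  elems :: "'v set"
  radd :: "'v \<Rightarrow> 'v \<Rightarrow> 'v"
  rscale :: "'k \<Rightarrow> 'v \<Rightarrow> 'v"
  ract :: "'g \<Rightarrow> 'v \<Rightarrow> 'v"

text \<open>\<open>V / N\<close> for submodules \<open>N \<subseteq> V\<close> that are stable under the action \<open>act\<close>. The elements are
  the cosets; the summand \<open>N\<close> turns the images of a coset into a full coset again.\<close>

definition quot_rep ::
  "('g \<Rightarrow> ('x \<Rightarrow> 'k) \<Rightarrow> 'x \<Rightarrow> 'k) \<Rightarrow> ('x \<Rightarrow> 'k) set \<Rightarrow> ('x \<Rightarrow> 'k::comm_ring_1) set
    \<Rightarrow> ('g, 'k, ('x \<Rightarrow> 'k) set) rep" where
  "quot_rep act V N =
     \<lparr> elems = (\<lambda>v. v +o N) ` V,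
       radd = (\<lambda>C C'. C + C'),
       rscale = (\<lambda>c C. fscale c ` C + N),
       ract = (\<lambda>g C. act g ` C + N) \<rparr>"

text \<open>The canonical map \<open>V / N \<rightarrow> V / N'\<close> for \<open>N \<subseteq> N'\<close>, and its kernel.\<close>

definition quot_map :: "('x \<Rightarrow> 'k) set \<Rightarrow> ('x \<Rightarrow> 'k) set \<Rightarrow> ('x \<Rightarrow> 'k::comm_ring_1) set" where
  "quot_map N' C = C + N'"

definition ker_quot_map ::
  "('g \<Rightarrow> ('x \<Rightarrow> 'k) \<Rightarrow> 'x \<Rightarrow> 'k) \<Rightarrow> ('x \<Rightarrow> 'k) set \<Rightarrow> ('x \<Rightarrow> 'k) set \<Rightarrow> ('x \<Rightarrow> 'k::comm_ring_1) set
    \<Rightarrow> ('g, 'k, ('x \<Rightarrow> 'k) set) rep" where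
  "ker_quot_map act V N N' =
     (quot_rep act V N)\<lparr> elems := {C \<in> elems (quot_rep act V N). quot_map N' C = N'} \<rparr>"

text \<open>The tensor product over \<open>'k\<close> with the diagonal action: the free module on pairs modulo the
  bilinearity relations.\<close>

definition free_on :: "'x set \<Rightarrow> ('x \<Rightarrow> 'k::comm_ring_1) set" where
  "free_on X = {f. finite {x. f x \<noteq> 0} \<and> {x. f x \<noteq> 0} \<subseteq> X}"

definition free_map :: "('x \<Rightarrow> 'x) \<Rightarrow> ('x \<Rightarrow> 'k) \<Rightarrow> 'x \<Rightarrow> 'k::comm_ring_1" where
  "free_map h f = (\<lambda>y. \<Sum>x | f x \<noteq> 0 \<and> h x = y. f x)"

definition bilinear_rels ::
  "('g, 'k::comm_ring_1, 'v) rep \<Rightarrow> ('g, 'k, 'w) rep \<Rightarrow> ('v \<times> 'w \<Rightarrow> 'k) set" where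
  "bilinear_rels M N = fscale.span
     ({basis_vec (radd M x x', y) - basis_vec (x, y) - basis_vec (x', y) | x x' y.
         x \<in> elems M \<and> x' \<in> elems M \<and> y \<in> elems N} \<union>
      {basis_vec (x, radd N y y') - basis_vec (x, y) - basis_vec (x, y') | x y y'.
         x \<in> elems M \<and> y \<in> elems N \<and> y' \<in> elems N} \<union>
      {basis_vec (rscale M c x, y) - fscale c (basis_vec (x, y)) | c x y.
         x \<in> elems M \<and> y \<in> elems N} \<union>
      {basis_vec (x, rscale N c y) - fscale c (basis_vec (x, y)) | c x y.
         x \<in> elems M \<and> y \<in> elems N})"

definition tensor_rep ::
  "('g, 'k::comm_ring_1, 'v) rep \<Rightarrow> ('g, 'k, 'w) rep \<Rightarrow> ('g, 'k, ('v \<times> 'w \<Rightarrow> 'k) set) rep" where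
  "tensor_rep M N =
     quot_rep (\<lambda>g. free_map (\<lambda>(x, y). (ract M g x, ract N g y)))
       (free_on (elems M \<times> elems N)) (bilinear_rels M N)"

definition rep_iso :: "'g set \<Rightarrow> ('g, 'k, 'v) rep \<Rightarrow> ('g, 'k, 'w) rep \<Rightarrow> bool" where
  "rep_iso G M N \<longleftrightarrow>
     (\<exists>\<phi>. bij_betw \<phi> (elems M) (elems N) \<and>
        (\<forall>x\<in>elems M. \<forall>y\<in>elems M. \<phi> (radd M x y) = radd N (\<phi> x) (\<phi> y)) \<and>
        (\<forall>c. \<forall>x\<in>elems M. \<phi> (rscale M c x) = rscale N c (\<phi> x)) \<and>
        (\<forall>g\<in>G. \<forall>x\<in>elems M. \<phi> (ract M g x) = ract N g (\<phi> x)))"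

section \<open>Flags of quotients\<close>

text \<open>\<open>E\<close> is free with basis \<open>z\<^sub>i =\<close> \<^term>\<open>basis_vec i\<close>, \<open>1 \<le> i \<le> n\<close>.\<close>

type_synonym 'k vec_E = "nat \<Rightarrow> 'k"

definition space_E :: "nat \<Rightarrow> 'k::comm_ring_1 vec_E set" where
  "space_E n = {v. \<forall>i. i \<notin> {1..n} \<longrightarrow> v i = 0}"

text \<open>A flag of quotients \<open>F\<^sub>n \<rightarrow> \<dots> \<rightarrow> F\<^sub>1\<close> of \<open>E\<close> is represented by the kernels
  \<open>F p = ker (E \<rightarrow> F\<^sub>p)\<close>.\<close>

type_synonym 'k flag = "nat \<Rightarrow> 'k vec_E set"

definition std_flag :: "nat \<Rightarrow> 'k::comm_ring_1 flag" where
  "std_flag n i = fscale.span (basis_vec ` {i + 1..n})"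

definition bs_op :: "nat \<Rightarrow> 'k flag \<Rightarrow> 'k flag" where
  "bs_op k F = (\<lambda>i. if i < k then F i else F (i - 1))"

text \<open>\<open>g i j\<close> is the coefficient of \<open>z\<^sub>i\<close> in \<open>g z\<^sub>j\<close>.\<close>

definition apply_E :: "nat \<Rightarrow> (nat \<Rightarrow> nat \<Rightarrow> 'k) \<Rightarrow> 'k vec_E \<Rightarrow> 'k::comm_ring_1 vec_E" where
  "apply_E n g v = (\<lambda>i. \<Sum>j\<in>{1..n}. g i j * v j)"

definition GL_E :: "nat \<Rightarrow> (nat \<Rightarrow> nat \<Rightarrow> 'k::comm_ring_1) set" where
  "GL_E n = {g. (\<forall>i j. i \<notin> {1..n} \<or> j \<notin> {1..n} \<longrightarrow> g i j = 0) \<and>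
     (\<exists>h. \<forall>i\<in>{1..n}. \<forall>j\<in>{1..n}.
        (\<Sum>l\<in>{1..n}. g i l * h l j) = (if i = j then 1 else 0) \<and>
        (\<Sum>l\<in>{1..n}. h i l * g l j) = (if i = j then 1 else 0))}"

definition lower_triangular :: "nat \<Rightarrow> (nat \<Rightarrow> nat \<Rightarrow> 'k::comm_ring_1) set" where
  "lower_triangular n = {g \<in> GL_E n. \<forall>i j. i < j \<longrightarrow> g i j = 0}"

text \<open>\<open>ker (F\<^sub>k \<rightarrow> F'\<^sub>k)\<close>.\<close>

definition flag_ker ::
  "nat \<Rightarrow> 'k flag \<Rightarrow> 'k flag \<Rightarrow> nat
    \<Rightarrow> (nat \<Rightarrow> nat \<Rightarrow> 'k, 'k::comm_ring_1, 'k vec_E set) rep" where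
  "flag_ker n F F' k = ker_quot_map (apply_E n) (space_E n) (F k) (F' k)"

section \<open>Flagged Schur modules\<close>

definition tableaux :: "nat \<Rightarrow> diagram \<Rightarrow> nat set list set" where
  "tableaux n D =
     {\<tau>. length \<tau> = length D \<and>
         (\<forall>j<length D. \<tau> ! j \<subseteq> {1..n} \<and> card (\<tau> ! j) = card (D ! j))}"

text \<open>\<open>TE\<^sup>D\<close> in coordinates with respect to its basis \<open>z\<^sub>\<tau>\<close>.\<close>

type_synonym 'k tens = "nat set list \<Rightarrow> 'k"

definition TE :: "nat \<Rightarrow> diagram \<Rightarrow> 'k::comm_ring_1 tens set" where
  "TE n D = {x. \<forall>\<tau>. \<tau> \<notin> tableaux n D \<longrightarrow> x \<tau> = 0}"

text \<open>The coefficient of \<open>z\<^bsub>b\<^sub>1\<^esub> \<and> \<dots> \<and> z\<^bsub>b\<^sub>r\<^esub>\<close> in \<open>v\<^sub>1 \<and> \<dots> \<and> v\<^sub>r\<close>,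
  for \<open>b = {b\<^sub>1 < \<dots> < b\<^sub>r}\<close>.\<close>

definition wedge_coeff :: "'k vec_E list \<Rightarrow> nat set \<Rightarrow> 'k::comm_ring_1" where
  "wedge_coeff vs b =
     det (mat (length vs) (length vs) (\<lambda>(i, j). (vs ! i) (sorted_list_of_set b ! j)))"

text \<open>The tensor product over \<open>j\<close> of the wedge products of the lists \<open>vss ! j\<close>.\<close>

definition tensor_of_wedges :: "nat \<Rightarrow> diagram \<Rightarrow> 'k vec_E list list \<Rightarrow> 'k::comm_ring_1 tens" where
  "tensor_of_wedges n D vss =
     (\<lambda>\<tau>. if \<tau> \<in> tableaux n D then \<Prod>j<length D. wedge_coeff (vss ! j) (\<tau> ! j) else 0)"

text \<open>The action of \<open>g\<close> by functoriality, that is, on each vector of a basis element \<open>z\<^sub>\<tau>\<close>.\<close>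

definition act_TE :: "nat \<Rightarrow> diagram \<Rightarrow> (nat \<Rightarrow> nat \<Rightarrow> 'k) \<Rightarrow> 'k tens \<Rightarrow> 'k::comm_ring_1 tens" where
  "act_TE n D g x =
     (\<Sum>\<tau>\<in>tableaux n D. fscale (x \<tau>)
        (tensor_of_wedges n D
          (map (\<lambda>b. map (\<lambda>q. apply_E n g (basis_vec q)) (sorted_list_of_set b)) \<tau>)))"

text \<open>The kernel of \<open>TE\<^sup>D \<rightarrow> TF\<^sup>D\<close>. A tensor product of quotients is the quotient of
  the tensor product by all pure tensors with a factor in one of the kernels; here the kernel of
  \<open>\<And>\<^sup>r E \<rightarrow> F\<^sup>a\<close> is generated by the
  \<open>v\<^sub>1 \<and> \<dots> \<and> v\<^sub>r\<close> such that for some \<open>i < r\<close> the vectors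
  \<open>v\<^bsub>i+1\<^esub>, \<dots>, v\<^sub>r\<close> vanish in \<open>F\<^bsub>a\<^bsub>i+1\<^esub>\<^esub>\<close>
  (lists are indexed from 0).\<close>

definition flag_rels :: "nat \<Rightarrow> 'k flag \<Rightarrow> diagram \<Rightarrow> 'k::comm_ring_1 tens set" where
  "flag_rels n F D = fscale.span
     {tensor_of_wedges n D vss | vss.
        length vss = length D \<and>
        (\<forall>j<length D. length (vss ! j) = card (D ! j) \<and> set (vss ! j) \<subseteq> space_E n) \<and>
        (\<exists>j<length D. \<exists>i<card (D ! j). \<forall>l. i \<le> l \<and> l < card (D ! j) \<longrightarrow>
           vss ! j ! l \<in> F (sorted_list_of_set (D ! j) ! i))}"

text \<open>The polynomial ring in the variables \<open>z\<^bsub>pq\<^esub>\<close>.\<close>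

type_synonym 'k zpoly = "((nat \<times> nat) \<Rightarrow>\<^sub>0 nat) \<Rightarrow>\<^sub>0 'k"

definition zconst :: "'k \<Rightarrow> 'k::comm_ring_1 zpoly" where
  "zconst c = Poly_Mapping.single 0 c"

definition generic_matrix :: "nat \<Rightarrow> nat \<Rightarrow> 'k::comm_ring_1 zpoly" where
  "generic_matrix p q = Poly_Mapping.single (Poly_Mapping.single (p, q) 1) 1"

definition flagged_matrix :: "'k flag \<Rightarrow> nat \<Rightarrow> nat \<Rightarrow> 'k::comm_ring_1 zpoly" where
  "flagged_matrix F p q = (if basis_vec q \<in> F p then 0 else generic_matrix p q)"

definition minor :: "(nat \<Rightarrow> nat \<Rightarrow> 'a) \<Rightarrow> nat set \<Rightarrow> nat set \<Rightarrow> 'a::comm_ring_1" where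
  "minor Z a b =
     det (mat (card a) (card a)
       (\<lambda>(i, j). Z (sorted_list_of_set a ! i) (sorted_list_of_set b ! j)))"

text \<open>The linear map \<open>z\<^sub>\<tau> \<mapsto> \<Prod>\<^sub>j \<Delta>\<^bsub>a\<^sub>j,b\<^sub>j\<^esub>\<close>, the minors being
  taken in the matrix \<open>Z\<close>.\<close>

definition minors_map ::
  "(nat \<Rightarrow> nat \<Rightarrow> 'k zpoly) \<Rightarrow> nat \<Rightarrow> diagram \<Rightarrow> 'k tens \<Rightarrow> 'k::comm_ring_1 zpoly" where
  "minors_map Z n D x =
     (\<Sum>\<tau>\<in>tableaux n D. zconst (x \<tau>) * (\<Prod>j<length D. minor Z (D ! j) (\<tau> ! j)))"

definition exchange_rels :: "nat \<Rightarrow> diagram \<Rightarrow> 'k::comm_ring_1 tens set" where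
  "exchange_rels n D = {x \<in> TE n D. minors_map generic_matrix n D x = 0}"

definition schur_rels :: "nat \<Rightarrow> 'k flag \<Rightarrow> diagram \<Rightarrow> 'k::comm_ring_1 tens set" where
  "schur_rels n F D = flag_rels n F D + exchange_rels n D"

definition schur_module ::
  "nat \<Rightarrow> 'k flag \<Rightarrow> diagram
    \<Rightarrow> (nat \<Rightarrow> nat \<Rightarrow> 'k, 'k::comm_ring_1, 'k tens set) rep" where
  "schur_module n F D = quot_rep (act_TE n D) (TE n D) (schur_rels n F D)"

text \<open>The kernel of the map \<open>F\<^sup>D \<rightarrow> F'\<^sup>D\<close> induced by a surjection of flags \<open>F \<rightarrow> F'\<close>
  under \<open>E\<close>.\<close>

definition schur_ker ::
  "nat \<Rightarrow> 'k flag \<Rightarrow> 'k flag \<Rightarrow> diagram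
    \<Rightarrow> (nat \<Rightarrow> nat \<Rightarrow> 'k, 'k::comm_ring_1, 'k tens set) rep" where
  "schur_ker n F F' D = ker_quot_map (act_TE n D) (TE n D) (schur_rels n F D) (schur_rels n F' D)"

text \<open>The identification of \<open>F\<^sup>D\<close> with a submodule of the polynomial ring via
  \<open>z\<^sub>\<tau> \<mapsto> \<Prod>\<^sub>j \<Delta>\<^bsub>a\<^sub>j,b\<^sub>j\<^esub>\<close>: the map induced on \<open>F\<^sup>D\<close> by the minors of the
  flagged matrix (it is well defined) is injective. This is a genuine condition on \<open>D\<close>: for the
  standard flag with \<open>n = 4\<close> and the columns \<open>{1, 4}\<close>, \<open>{2, 4}\<close>, the difference of
  \<open>z\<^sub>\<tau>\<close> for \<open>\<tau> = ({1, 3}, {1, 4})\<close> and \<open>\<tau> = ({1, 4}, {1, 3})\<close> is mapped to 0 but is not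
  zero in \<open>F\<^sup>D\<close>.\<close>

definition embeds_in_polys :: "nat \<Rightarrow> 'k::comm_ring_1 flag \<Rightarrow> diagram \<Rightarrow> bool" where
  "embeds_in_polys n F D \<longleftrightarrow>
     (\<forall>x \<in> TE n D. minors_map (flagged_matrix F) n D x = 0 \<longrightarrow> x \<in> schur_rels n F D)"

end

theory Submission
  imports Defs
begin

text \<open>Write \<open>F = R\<^bsub>k+1\<^esub>E\<close> and \<open>F' = R\<^sub>kE\<close>, let \<open>a\<close> be the witnessing column of the
  descent and \<open>D\<^sup>-\<close> the diagram \<open>D\<close> without the box \<open>k\<close> of \<open>a\<close>. Products of minors of the matrix for
  \<open>F\<close> embed \<open>F\<^sup>D\<close> into polynomials, and the kernel in question becomes the span of the products in
  which some column contains \<open>k\<close> as its \<open>(i + 1)\<close>-st box and the vectors from position \<open>i + 1\<close> on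
  lie in \<open>\<langle>z\<^sub>k, \<dots>, z\<^sub>n\<rangle>\<close>. This span equals \<open>z\<^bsub>kk\<^esub>\<close> times the span of the products of minors for
  \<open>D\<^sup>-\<close>. If the column is \<open>a\<close>, expand along its last column. If it is \<open>k\<close>-full, the minor vanishes
  because the rows \<open>k\<close> and \<open>k + 1\<close> are proportional on these vectors. Otherwise its boxes above \<open>k\<close>
  are boxes of \<open>a\<close>, and an exchange relation between the two columns moves the box \<open>k\<close>.
  The rows \<open>k\<close> and \<open>k + 1\<close> of the matrix for \<open>F\<close> have the same shape, so swapping their variables
  identifies the module of \<open>D\<^sup>-\<close> with that of \<open>s\<^sub>kD\<close>, while \<open>B\<close> acts on \<open>z\<^bsub>kk\<^esub>\<close> by the same
  character as on \<open>K\<^sub>k\<close>.\<close>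

section \<open>Realising representations in a module\<close>

text \<open>The records for representations carry no module laws, so they are compared through
  injective maps into a common abelian group with a scalar operation \<open>s\<close> and an action
  \<open>\<theta>\<close>. Below this group is the polynomial ring, or the base ring itself. The
  image of \<beta> is left open: it decides which submodule is realised.\<close>

definition realizes ::
  "'g set \<Rightarrow> ('g, 'k, 'v) rep \<Rightarrow> ('k \<Rightarrow> 'p \<Rightarrow> 'p) \<Rightarrow> ('g \<Rightarrow> 'p \<Rightarrow> 'p) \<Rightarrow> ('v \<Rightarrow> 'p::ab_group_add) \<Rightarrow> bool"
  where
  "realizes G M s \<theta> \<beta> \<longleftrightarrow> inj_on \<beta> (elems M) \<and>
     (\<forall>x\<in>elems M. \<forall>y\<in>elems M. radd M x y \<in> elems M \<and> \<beta> (radd M x y) = \<beta> x + \<beta> y) \<and>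
     (\<forall>c. \<forall>x\<in>elems M. rscale M c x \<in> elems M \<and> \<beta> (rscale M c x) = s c (\<beta> x)) \<and>
     (\<forall>g\<in>G. \<forall>x\<in>elems M. ract M g x \<in> elems M \<and> \<beta> (ract M g x) = \<theta> g (\<beta> x))"

lemma realizesD:
  assumes "realizes G M s \<theta> \<beta>"
  shows "inj_on \<beta> (elems M)"
    "\<And>x y. x \<in> elems M \<Longrightarrow> y \<in> elems M \<Longrightarrow> radd M x y \<in> elems M"
    "\<And>x y. x \<in> elems M \<Longrightarrow> y \<in> elems M \<Longrightarrow> \<beta> (radd M x y) = \<beta> x + \<beta> y"
    "\<And>c x. x \<in> elems M \<Longrightarrow> rscale M c x \<in> elems M"
    "\<And>c x. x \<in> elems M \<Longrightarrow> \<beta> (rscale M c x) = s c (\<beta> x)"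
    "\<And>g x. g \<in> G \<Longrightarrow> x \<in> elems M \<Longrightarrow> ract M g x \<in> elems M"
    "\<And>g x. g \<in> G \<Longrightarrow> x \<in> elems M \<Longrightarrow> \<beta> (ract M g x) = \<theta> g (\<beta> x)"
  using assms by (auto simp: realizes_def)

text \<open>The isomorphism is \<beta> followed by the inverse of \<gamma> on the common image. Each
  compatibility is checked after applying the injective \<gamma>.\<close>

lemma rep_iso_if_same_realization:
  assumes M: "realizes G M s \<theta> \<beta>" and N: "realizes G N s \<theta> \<gamma>"
    and im: "\<beta> ` elems M = \<gamma> ` elems N"
  shows "rep_iso G M N"
proof -
  define \<phi> where "\<phi> = inv_into (elems N) \<gamma> \<circ> \<beta>"
  note m = realizesD[OF M] and n = realizesD[OF N]
  have b: "bij_betw \<phi> (elems M) (elems N)"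
    unfolding \<phi>_def
    by (rule bij_betw_trans[OF inj_on_imp_bij_betw[OF m(1)]])
       (use bij_betw_inv_into[OF inj_on_imp_bij_betw[OF n(1)]] im in simp)
  have mem: "\<phi> x \<in> elems N" if "x \<in> elems M" for x using b that by (auto simp: bij_betw_def)
  have val: "\<gamma> (\<phi> x) = \<beta> x" if "x \<in> elems M" for x
    using that im unfolding \<phi>_def by (metis comp_apply f_inv_into_f image_eqI)
  have eqI: "x = y" if "x \<in> elems N" "y \<in> elems N" "\<gamma> x = \<gamma> y" for x y
    using that n(1) by (meson inj_onD)
  show ?thesis
    unfolding rep_iso_def
    by (intro exI[of _ \<phi>] conjI b ballI allI; rule eqI)
       (auto simp: mem val m n)
qed

text \<open>The actions need to be intertwined only on the image of \<beta>. This allows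
  multiplication by \<open>z_kk\<close> as \<psi>, where \<open>\<theta>\<close> and
  \<open>\<theta>'\<close> differ by a character.\<close>

lemma realizes_comp:
  assumes M: "realizes G M s \<theta> \<beta>" and inj: "inj \<psi>"
    and add: "\<And>p q. \<psi> (p + q) = \<psi> p + \<psi> q" and scale: "\<And>c p. \<psi> (s c p) = s' c (\<psi> p)"
    and act: "\<And>g x. g \<in> G \<Longrightarrow> x \<in> elems M \<Longrightarrow> \<theta>' g (\<psi> (\<beta> x)) = \<psi> (\<theta> g (\<beta> x))"
  shows "realizes G M s' \<theta>' (\<psi> \<circ> \<beta>)"
  unfolding realizes_def
  using realizesD[OF M] add scale act inj by (auto intro!: comp_inj_on intro: inj_on_subset)

section \<open>Quotients by the kernel of a map\<close>

text \<open>Setting of the first isomorphism theorem: \<open>N\<close> is the kernel of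
  \<open>m\<close> on \<open>V\<close>, so \<open>V / N\<close> is realised by the values of
  \<open>m\<close>. Everything is required on \<open>V\<close> only, because \<open>m\<close> is
  later restricted to submodules.\<close>

locale quot_by_map =
  fixes G :: "'g set" and act :: "'g \<Rightarrow> ('x \<Rightarrow> 'k) \<Rightarrow> 'x \<Rightarrow> 'k::comm_ring_1"
    and V N :: "('x \<Rightarrow> 'k) set" and s :: "'k \<Rightarrow> 'p \<Rightarrow> 'p::ab_group_add"
    and \<theta> :: "'g \<Rightarrow> 'p \<Rightarrow> 'p" and m :: "('x \<Rightarrow> 'k) \<Rightarrow> 'p"
  assumes V: "fscale.subspace V"
    and N: "N = {v \<in> V. m v = 0}"
    and m_add: "\<And>u v. u \<in> V \<Longrightarrow> v \<in> V \<Longrightarrow> m (u + v) = m u + m v"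
    and m_scale: "\<And>c v. v \<in> V \<Longrightarrow> m (fscale c v) = s c (m v)"
    and act_mem: "\<And>g v. g \<in> G \<Longrightarrow> v \<in> V \<Longrightarrow> act g v \<in> V"
    and m_act: "\<And>g v. g \<in> G \<Longrightarrow> v \<in> V \<Longrightarrow> m (act g v) = \<theta> g (m v)"
begin

lemma m_diff: "u \<in> V \<Longrightarrow> v \<in> V \<Longrightarrow> m (u - v) = m u - m v"
  using m_add[of "u - v" v] fscale.subspace_diff[OF V] by (simp add: algebra_simps)

lemma coset_eq: "v \<in> V \<Longrightarrow> v +o N = {u \<in> V. m u = m v}"
proof -
  assume v: "v \<in> V"
  have "\<exists>b\<in>N. u = v + b" if "u \<in> V" "m u = m v" for u
    using that v m_diff[of u v] fscale.subspace_diff[OF V, of u v] unfolding N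
    by (intro bexI[of _ "u - v"]) auto
  then show ?thesis
    using v fscale.subspace_add[OF V] m_add by (auto simp: elt_set_plus_def N)
qed

text \<open>The map induced by \<open>m\<close> on cosets. A coset is a fibre of \<open>m\<close> on
  \<open>V\<close>, so the choice of the representative does not matter.\<close>

definition val :: "('x \<Rightarrow> 'k) set \<Rightarrow> 'p" where
  "val C = m (SOME v. v \<in> C)"

lemma val_coset: "v \<in> V \<Longrightarrow> val (v +o N) = m v"
  unfolding val_def coset_eq by (rule someI2[of _ v]) auto

lemma coset_inject: "u \<in> V \<Longrightarrow> v \<in> V \<Longrightarrow> m u = m v \<Longrightarrow> u +o N = v +o N"
  by (simp add: coset_eq)

text \<open>An operation that respects the fibres of \<open>m\<close> sends a coset into a coset,
  and adding \<open>N\<close> fills it up. Scalars and group elements are both treated this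
  way.\<close>

lemma image_plus_N:
  assumes h: "\<And>u. u \<in> V \<Longrightarrow> h u \<in> V" "\<And>u. u \<in> V \<Longrightarrow> m u = m v \<Longrightarrow> m (h u) = m (h v)" and v: "v \<in> V"
  shows "h ` (v +o N) + N = h v +o N"
proof
  show "h ` (v +o N) + N \<subseteq> h v +o N"
    unfolding set_plus_def coset_eq[OF v] coset_eq[OF h(1)[OF v]]
    using h fscale.subspace_add[OF V] m_add by (auto simp: N)
  have "h v \<in> h ` (v +o N)" using v coset_eq by auto
  then show "h v +o N \<subseteq> h ` (v +o N) + N" by (auto simp: elt_set_plus_def set_plus_def)
qed

lemma realizes_quot: "realizes G (quot_rep act V N) s \<theta> val"
proof -
  have add: "u +o N + (v +o N) = (u + v) +o N" if "u \<in> V" "v \<in> V" for u v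
  proof -
    have "u + v \<in> V" using fscale.subspace_add[OF V] that by blast
    have "w \<in> u +o N + (v +o N)" if "w \<in> V" "m w = m (u + v)" for w
    proof -
      have "w = u + (w - u)" by simp
      moreover have "u \<in> u +o N" using \<open>u \<in> V\<close> coset_eq by auto
      moreover have "w - u \<in> v +o N"
        using that \<open>u \<in> V\<close> \<open>v \<in> V\<close> m_diff m_add fscale.subspace_diff[OF V] by (auto simp: coset_eq)
      ultimately show ?thesis by (metis set_plus_intro)
    qed
    then show ?thesis
      using that m_add fscale.subspace_add[OF V] \<open>u + v \<in> V\<close>
      by (auto simp: coset_eq set_plus_def)
  qed
  have scale: "fscale c ` (v +o N) + N = fscale c v +o N" if "v \<in> V" for c v
    by (rule image_plus_N) (use that V m_scale fscale.subspace_scale in auto)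
  have act: "act g ` (v +o N) + N = act g v +o N" if "v \<in> V" "g \<in> G" for g v
    by (rule image_plus_N) (use that act_mem m_act in auto)
  have *: "fscale c v \<in> V" if "v \<in> V" for c v using V that fscale.subspace_scale by blast
  have **: "u + v \<in> V" if "u \<in> V" "v \<in> V" for u v using V that fscale.subspace_add by blast
  have "inj_on val (elems (quot_rep act V N))"
  proof (rule inj_onI)
    fix C D assume "C \<in> elems (quot_rep act V N)" "D \<in> elems (quot_rep act V N)" "val C = val D"
    moreover from this obtain u v where "C = u +o N" "u \<in> V" "D = v +o N" "v \<in> V"
      by (auto simp: quot_rep_def)
    ultimately show "C = D" by (metis coset_inject val_coset)
  qed
  then show ?thesis
    unfolding realizes_def quot_rep_def
    by (auto simp: add scale act val_coset * ** m_add m_scale m_act act_mem)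
qed

lemma val_image: "val ` elems (quot_rep act V N) = m ` V"
  by (auto simp: quot_rep_def val_coset image_image intro!: image_cong)

end

lemma sum_fun_apply: "(\<Sum>i\<in>A. f i) x = (\<Sum>i\<in>A. f i x)" for f :: "'i \<Rightarrow> 'x \<Rightarrow> 'k::comm_monoid_add"
  by (induction A rule: infinite_finite_induct) auto

text \<open>The kernel of \<open>V / N \<rightarrow> V / N'\<close> is \<open>N' / N\<close>. The
  records are even equal, since the operations of \<open>quot_rep\<close> depend on \<open>N\<close>
  alone and not on \<open>V\<close>.\<close>

lemma ker_quot_map_eq:
  assumes N': "fscale.subspace N'" and sub: "N \<subseteq> N'" "N' \<subseteq> V" "0 \<in> N"
  shows "ker_quot_map act V N N' = quot_rep act N' N"
proof -
  have eq: "v +o N + N' = v +o N'" for v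
    using sub fscale.subspace_add[OF N']
    by (auto simp: elt_set_plus_def set_plus_def)
  have iff: "v +o N' = N' \<longleftrightarrow> v \<in> N'" for v
  proof
    assume "v +o N' = N'"
    moreover have "v + 0 \<in> v +o N'" using fscale.subspace_0[OF N'] by (rule set_plus_intro2)
    ultimately show "v \<in> N'" by simp
  next
    assume v: "v \<in> N'"
    have "x \<in> v +o N'" if "x \<in> N'" for x
      using fscale.subspace_diff[OF N' that v] set_plus_intro2[of "x - v" N' v] by simp
    then show "v +o N' = N'"
      using fscale.subspace_add[OF N' v] by (auto simp: elt_set_plus_def)
  qed
  have "{v \<in> V. v +o N + N' = N'} = N'" unfolding eq iff using sub(2) by blast
  then have "{C \<in> (\<lambda>v. v +o N) ` V. C + N' = N'} = (\<lambda>v. v +o N) ` N'" by blast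
  then show ?thesis
    unfolding ker_quot_map_def quot_map_def quot_rep_def by simp
qed

section \<open>Tensor products with a free module of rank one\<close>

text \<open>Here \<open>M\<close> is identified by \<alpha> with the ring itself, and the group acts
  on it through the character \<chi>. Hence \<open>M \<otimes> N\<close> is \<open>N\<close> with
  the action twisted by \<chi>, and it is realised in the same group as \<open>N\<close>.\<close>

locale rank_one_tensor = Modules.module s
  for s :: "'k::comm_ring_1 \<Rightarrow> 'p::ab_group_add \<Rightarrow> 'p" +
  fixes G :: "'g set" and M :: "('g, 'k, 'v) rep" and N :: "('g, 'k, 'w) rep"
    and \<chi> :: "'g \<Rightarrow> 'k" and \<theta> :: "'g \<Rightarrow> 'p \<Rightarrow> 'p" and \<alpha> :: "'v \<Rightarrow> 'k" and \<beta> :: "'w \<Rightarrow> 'p"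
  assumes M: "realizes G M (*) (\<lambda>g c. \<chi> g * c) \<alpha>" and range_\<alpha>: "\<alpha> ` elems M = UNIV"
    and N: "realizes G N s \<theta> \<beta>" and N_ne: "elems N \<noteq> {}"
    and \<theta>_add: "\<And>g p q. g \<in> G \<Longrightarrow> \<theta> g (p + q) = \<theta> g p + \<theta> g q"
    and \<theta>_scale: "\<And>g c p. g \<in> G \<Longrightarrow> \<theta> g (s c p) = s c (\<theta> g p)"
begin

text \<open>The linear extension of \<open>x \<otimes> y \<mapsto> \<alpha> x \<beta> y\<close> to
  the free module on pairs.\<close>

definition eval :: "('v \<times> 'w \<Rightarrow> 'k) \<Rightarrow> 'p" where
  "eval f = (\<Sum>z | f z \<noteq> 0. s (f z * \<alpha> (fst z)) (\<beta> (snd z)))"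

lemma eval_superset:
  assumes "finite S" "{z. f z \<noteq> 0} \<subseteq> S"
  shows "eval f = (\<Sum>z\<in>S. s (f z * \<alpha> (fst z)) (\<beta> (snd z)))"
  unfolding eval_def by (rule sum.mono_neutral_left) (use assms in auto)

abbreviation "X \<equiv> elems M \<times> elems N"
abbreviation "F \<equiv> free_on X :: ('v \<times> 'w \<Rightarrow> 'k) set"

lemma subspace_F: "fscale.subspace F"
proof -
  have "f + g \<in> F" if "f \<in> F" "g \<in> F" for f g
  proof -
    have "{x. (f + g) x \<noteq> 0} \<subseteq> {x. f x \<noteq> 0} \<union> {x. g x \<noteq> 0}" by auto
    with that show ?thesis unfolding free_on_def by (blast intro: finite_subset)
  qed
  moreover have "fscale c f \<in> F" if "f \<in> F" for c f
  proof -
    have "{x. fscale c f x \<noteq> 0} \<subseteq> {x. f x \<noteq> 0}" by (auto simp: fscale_def)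
    with that show ?thesis unfolding free_on_def by (blast intro: finite_subset)
  qed
  moreover have "0 \<in> F" by (simp add: free_on_def)
  ultimately show ?thesis unfolding fscale.subspace_def by blast
qed

lemma eval_add: "eval (f + g) = eval f + eval g" if "f \<in> F" "g \<in> F" for f g
proof -
  let ?S = "{z. f z \<noteq> 0} \<union> {z. g z \<noteq> 0}"
  have S: "finite ?S" using that by (auto simp: free_on_def)
  have "eval (f + g) = (\<Sum>z\<in>?S. s ((f + g) z * \<alpha> (fst z)) (\<beta> (snd z)))"
    by (rule eval_superset[OF S]) auto
  also have "\<dots> = eval f + eval g"
    by (subst (1 2) eval_superset[OF S]) (auto simp: algebra_simps scale_left_distrib sum.distrib)
  finally show ?thesis .
qed

lemma eval_scale: "eval (fscale c f) = s c (eval f)" if "f \<in> F" for c f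
proof -
  have "eval (fscale c f) = (\<Sum>z | f z \<noteq> 0. s (fscale c f z * \<alpha> (fst z)) (\<beta> (snd z)))"
    by (rule eval_superset) (use that in \<open>auto simp: free_on_def fscale_def\<close>)
  then show ?thesis
    by (simp add: eval_def scale_sum_right fscale_def mult.assoc)
qed

lemma basis_mem: "z \<in> X \<Longrightarrow> basis_vec z \<in> F"
proof -
  have "{x. basis_vec z x \<noteq> (0::'k)} = {z}" by (auto simp: basis_vec_def)
  then show "z \<in> X \<Longrightarrow> basis_vec z \<in> F" by (auto simp: free_on_def)
qed

lemma eval_basis: "eval (basis_vec z) = s (\<alpha> (fst z)) (\<beta> (snd z))"
proof -
  have "{x. basis_vec z x \<noteq> (0::'k)} = {z}" by (auto simp: basis_vec_def)
  then show ?thesis by (simp add: eval_def) (simp add: basis_vec_def)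
qed

lemma eval_diff: "eval (f - g) = eval f - eval g" if "f \<in> F" "g \<in> F" for f g
  using eval_add[of "f - g" g] that fscale.subspace_diff[OF subspace_F that] by (simp add: algebra_simps)

lemma rels_sub: "f \<in> bilinear_rels M N \<Longrightarrow> f \<in> F \<and> eval f = 0"
  unfolding bilinear_rels_def
proof (induction rule: fscale.span_induct)
  case base
  show ?case
    unfolding fscale.subspace_def
    using fscale.subspace_0[OF subspace_F] fscale.subspace_add[OF subspace_F]
      fscale.subspace_scale[OF subspace_F] eval_add eval_scale
    by (auto simp: eval_def)
next
  case (step f)
  note m = realizesD[OF M] and n = realizesD[OF N]
  have sc: "fscale c (basis_vec z) \<in> F" if "z \<in> X" for c z
    by (rule fscale.subspace_scale[OF subspace_F basis_mem[OF that]])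
  have d: "f - g \<in> F \<and> eval (f - g) = 0" if "f \<in> F" "g \<in> F" "eval f = eval g" for f g
    using that eval_diff fscale.subspace_diff[OF subspace_F] by auto
  have d2: "f - g - h \<in> F \<and> eval (f - g - h) = 0" if "f \<in> F" "g \<in> F" "h \<in> F" "eval f = eval g + eval h" for f g h
    using d[of f "g + h"] that fscale.subspace_add[OF subspace_F] eval_add by (simp add: diff_diff_eq)
  note simps = eval_basis eval_scale basis_mem scale_left_distrib scale_right_distrib sc
  from step consider
      (1) x x' y where "f = basis_vec (radd M x x', y) - basis_vec (x, y) - basis_vec (x', y)"
        "x \<in> elems M" "x' \<in> elems M" "y \<in> elems N"
    | (2) x y y' where "f = basis_vec (x, radd N y y') - basis_vec (x, y) - basis_vec (x, y')"
        "x \<in> elems M" "y \<in> elems N" "y' \<in> elems N"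
    | (3) c x y where "f = basis_vec (rscale M c x, y) - fscale c (basis_vec (x, y))"
        "x \<in> elems M" "y \<in> elems N"
    | (4) c x y where "f = basis_vec (x, rscale N c y) - fscale c (basis_vec (x, y))"
        "x \<in> elems M" "y \<in> elems N"
    by blast
  then show ?case
  proof cases
    case 1 show ?thesis unfolding 1(1) by (rule d2) (use 1 in \<open>simp_all add: m n simps\<close>)
  next
    case 2 show ?thesis unfolding 2(1) by (rule d2) (use 2 in \<open>simp_all add: m n simps\<close>)
  next
    case 3 show ?thesis unfolding 3(1) by (rule d) (use 3 in \<open>simp_all add: m n simps\<close>)
  next
    case 4 show ?thesis unfolding 4(1) by (rule d) (use 4 in \<open>simp_all add: m n simps mult.commute\<close>)
  qed
qed

definition \<kappa> :: 'v where "\<kappa> = inv_into (elems M) \<alpha> 1"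

lemma \<kappa>: "\<kappa> \<in> elems M" "\<alpha> \<kappa> = 1"
  unfolding \<kappa>_def using range_\<alpha> by (auto intro: inv_into_into f_inv_into_f)

text \<open>Every tensor is a simple tensor \<open>\<kappa> \<otimes> y\<close> with the generator
  \<kappa> of \<open>M\<close>: pairs are brought to this form by moving scalars across, and the
  tensors of this form are closed under sums and multiples.\<close>

lemma mod_rels_simple: "f \<in> F \<Longrightarrow> \<exists>y\<in>elems N. f - basis_vec (\<kappa>, y) \<in> bilinear_rels M N"
proof -
  let ?R = "bilinear_rels M N"
  let ?W = "{f. \<exists>y\<in>elems N. f - basis_vec (\<kappa>, y) \<in> ?R}"
  note m = realizesD[OF M] and n = realizesD[OF N]
  have R: "fscale.subspace ?R" unfolding bilinear_rels_def by (rule fscale.subspace_span)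
  have r2: "basis_vec (\<kappa>, radd N y y') - basis_vec (\<kappa>, y) - basis_vec (\<kappa>, y') \<in> ?R"
    if "y \<in> elems N" "y' \<in> elems N" for y y'
    unfolding bilinear_rels_def by (rule fscale.span_base) (use that \<kappa> in blast)
  have r3: "basis_vec (rscale M c x, y) - fscale c (basis_vec (x, y)) \<in> ?R"
    if "x \<in> elems M" "y \<in> elems N" for c x y
    unfolding bilinear_rels_def by (rule fscale.span_base) (use that in blast)
  have r4: "basis_vec (x, rscale N c y) - fscale c (basis_vec (x, y)) \<in> ?R"
    if "x \<in> elems M" "y \<in> elems N" for c x y
    unfolding bilinear_rels_def by (rule fscale.span_base) (use that in blast)
  have Wadd: "f + g \<in> ?W" if fg: "f \<in> ?W" "g \<in> ?W" for f g
  proof -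
    obtain y y' where y: "y \<in> elems N" "f - basis_vec (\<kappa>, y) \<in> ?R"
      "y' \<in> elems N" "g - basis_vec (\<kappa>, y') \<in> ?R" using fg by blast
    have "(f - basis_vec (\<kappa>, y)) + (g - basis_vec (\<kappa>, y'))
        - (basis_vec (\<kappa>, radd N y y') - basis_vec (\<kappa>, y) - basis_vec (\<kappa>, y')) \<in> ?R"
      by (intro fscale.subspace_diff[OF R] fscale.subspace_add[OF R] y r2)
    then have "f + g - basis_vec (\<kappa>, radd N y y') \<in> ?R" by (simp add: algebra_simps)
    then show ?thesis using n(2) y by blast
  qed
  have Wscale: "fscale c f \<in> ?W" if f: "f \<in> ?W" for c f
  proof -
    obtain y where y: "y \<in> elems N" "f - basis_vec (\<kappa>, y) \<in> ?R" using f by blast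
    have "fscale c (f - basis_vec (\<kappa>, y))
        - (basis_vec (\<kappa>, rscale N c y) - fscale c (basis_vec (\<kappa>, y))) \<in> ?R"
      by (intro fscale.subspace_diff[OF R] fscale.subspace_scale[OF R] y r4 \<kappa>)
    then have "fscale c f - basis_vec (\<kappa>, rscale N c y) \<in> ?R"
      by (simp add: fscale.scale_right_diff_distrib)
    then show ?thesis using n(4) y by blast
  qed
  have Wbasis: "basis_vec z \<in> ?W" if z: "z \<in> X" for z
  proof -
    obtain x y where xy: "z = (x, y)" "x \<in> elems M" "y \<in> elems N" using z by auto
    have x: "x = rscale M (\<alpha> x) \<kappa>"
      by (rule inj_onD[OF m(1)]) (use xy m \<kappa> in auto)
    \<comment> \<open>The scalar \<open>\<alpha> x\<close> leaves the first factor by one relation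
      and enters the second by another.\<close>
    have "(basis_vec (rscale M (\<alpha> x) \<kappa>, y) - fscale (\<alpha> x) (basis_vec (\<kappa>, y)))
      - (basis_vec (\<kappa>, rscale N (\<alpha> x) y) - fscale (\<alpha> x) (basis_vec (\<kappa>, y))) \<in> ?R"
      by (intro fscale.subspace_diff[OF R] r3 r4 \<kappa> xy)
    then have "basis_vec z - basis_vec (\<kappa>, rscale N (\<alpha> x) y) \<in> ?R" using x xy by simp
    then show ?thesis using n(4) xy by blast
  qed
  have W0: "0 \<in> ?W"
  proof -
    obtain y where "y \<in> elems N" using N_ne by blast
    from Wscale[OF Wbasis[of "(\<kappa>, y)"], of 0] this \<kappa> show ?thesis by (simp add: fscale_def zero_fun_def)
  qed
  assume f: "f \<in> F"
  have "f = (\<Sum>z | f z \<noteq> 0. fscale (f z) (basis_vec z))"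
  proof
    fix x
    have "(\<Sum>z | f z \<noteq> 0. f z * basis_vec z x) = (\<Sum>z | f z \<noteq> 0. if z = x then f z else 0)"
      by (rule sum.cong) (auto simp: basis_vec_def)
    then show "f x = (\<Sum>z | f z \<noteq> 0. fscale (f z) (basis_vec z)) x"
      using f by (auto simp: sum_fun_apply fscale_def free_on_def)
  qed
  moreover have "(\<Sum>z\<in>S. fscale (f z) (basis_vec z)) \<in> ?W" if "finite S" "S \<subseteq> X" for S
    using that
  proof induction
    case empty
    show ?case using W0 by (simp only: sum.empty)
  next
    case (insert z S)
    then have "fscale (f z) (basis_vec z) + (\<Sum>z\<in>S. fscale (f z) (basis_vec z)) \<in> ?W"
      by (intro Wadd[OF Wscale[OF Wbasis]]) blast+
    then show ?case by (subst sum.insert[OF insert.hyps])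
  qed
  ultimately have "f \<in> ?W" using f unfolding free_on_def by (metis (no_types, lifting) mem_Collect_eq)
  then show ?thesis by blast
qed

text \<open>Modulo the relations \<open>f\<close> is \<open>\<kappa> \<otimes> y\<close>, and
  \<open>eval f = \<beta> y\<close>. If this vanishes, injectivity of \<beta> makes \<open>y\<close>
  the zero of \<open>N\<close>, so \<open>\<kappa> \<otimes> y\<close> is itself a relation.\<close>

lemma rels_eq: "bilinear_rels M N = {f \<in> F. eval f = 0}"
proof (intro Set.set_eqI iffI)
  fix f assume "f \<in> {f \<in> F. eval f = 0}"
  then have f: "f \<in> F" "eval f = 0" by auto
  let ?R = "bilinear_rels M N"
  note m = realizesD[OF M] and n = realizesD[OF N]
  have R: "fscale.subspace ?R" unfolding bilinear_rels_def by (rule fscale.subspace_span)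
  obtain y where y: "y \<in> elems N" "f - basis_vec (\<kappa>, y) \<in> ?R" using mod_rels_simple f by blast
  have "eval f = eval (basis_vec (\<kappa>, y))"
    using rels_sub[OF y(2)] eval_diff[OF f(1) basis_mem] y \<kappa> by auto
  then have "\<beta> y = 0" using f \<kappa> by (simp add: eval_basis)
  \<comment> \<open>The record has no named zero; the multiple by the scalar 0 takes its
    place.\<close>
  then have "y = rscale N 0 y"
    by (intro inj_onD[OF n(1)]) (use n y in auto)
  moreover have "basis_vec (\<kappa>, rscale N 0 y) - fscale 0 (basis_vec (\<kappa>, y)) \<in> ?R"
    unfolding bilinear_rels_def by (rule fscale.span_base) (use y \<kappa> in blast)
  ultimately have "basis_vec (\<kappa>, y) \<in> ?R" by simp
  from fscale.subspace_add[OF R y(2) this] show "f \<in> ?R" by (simp only: diff_add_cancel)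
qed (use rels_sub in blast)

lemma \<theta>_zero: "g \<in> G \<Longrightarrow> \<theta> g 0 = 0"
  using \<theta>_add[of g 0 0] by simp

lemma \<theta>_sum: "g \<in> G \<Longrightarrow> \<theta> g (sum h A) = (\<Sum>a\<in>A. \<theta> g (h a))"
  by (induction A rule: infinite_finite_induct) (auto simp: \<theta>_zero \<theta>_add)

text \<open>Several points of the support may have the same image under \<open>h\<close>, so the sum
  over the image is regrouped into fibres. The character comes out of the first factor and \<theta>
  out of the second.\<close>

lemma free_map_eval:
  assumes g: "g \<in> G" and f: "f \<in> F"
  defines "h \<equiv> \<lambda>(x, y). (ract M g x, ract N g y)"
  shows "free_map h f \<in> F" "eval (free_map h f) = s (\<chi> g) (\<theta> g (eval f))"
proof -
  let ?S = "{z. f z \<noteq> 0}"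
  note m = realizesD[OF M] and n = realizesD[OF N]
  have S: "finite ?S" "?S \<subseteq> X" using f by (auto simp: free_on_def)
  have hX: "h z \<in> X" if "z \<in> X" for z using that g m n by (auto simp: h_def)
  have supp: "{z. free_map h f z \<noteq> 0} \<subseteq> h ` ?S"
  proof
    fix y assume "y \<in> {z. free_map h f z \<noteq> 0}"
    then have nz: "free_map h f y \<noteq> 0" by (rule CollectD)
    show "y \<in> h ` ?S"
    proof (rule ccontr)
      assume "y \<notin> h ` ?S"
      then have "{x. f x \<noteq> 0 \<and> h x = y} = {}" by blast
      with nz show False by (simp add: free_map_def)
    qed
  qed
  moreover have "finite (h ` ?S)" "h ` ?S \<subseteq> X" using S hX by blast+
  ultimately show "free_map h f \<in> F" unfolding free_on_def by (blast intro: finite_subset)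
  have "eval (free_map h f) = (\<Sum>z\<in>h ` ?S. s (free_map h f z * \<alpha> (fst z)) (\<beta> (snd z)))"
    by (rule eval_superset) (use S supp in auto)
  also have "\<dots> = (\<Sum>z\<in>h ` ?S. \<Sum>x\<in>{x \<in> ?S. h x = z}. s (f x * \<alpha> (fst (h x))) (\<beta> (snd (h x))))"
  proof (rule sum.cong[OF refl])
    fix z
    have "s (free_map h f z * \<alpha> (fst z)) (\<beta> (snd z))
        = (\<Sum>x\<in>{x \<in> ?S. h x = z}. s (f x * \<alpha> (fst z)) (\<beta> (snd z)))"
      by (simp add: free_map_def sum_distrib_right scale_sum_left)
    also have "\<dots> = (\<Sum>x\<in>{x \<in> ?S. h x = z}. s (f x * \<alpha> (fst (h x))) (\<beta> (snd (h x))))"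
      by (rule sum.cong) auto
    finally show "s (free_map h f z * \<alpha> (fst z)) (\<beta> (snd z)) = \<dots>" .
  qed
  also have "\<dots> = (\<Sum>x\<in>?S. s (f x * \<alpha> (fst (h x))) (\<beta> (snd (h x))))"
    by (rule sum.image_gen[OF S(1), symmetric])
  also have "\<dots> = (\<Sum>x\<in>?S. s (\<chi> g) (\<theta> g (s (f x * \<alpha> (fst x)) (\<beta> (snd x)))))"
    by (intro sum.cong refl) (use S(2) g m n in \<open>auto simp: h_def \<theta>_scale mult_ac\<close>)
  finally show "eval (free_map h f) = s (\<chi> g) (\<theta> g (eval f))"
    using g by (simp add: eval_def \<theta>_sum scale_sum_right)
qed

sublocale tensor: quot_by_map G "\<lambda>g. free_map (\<lambda>(x, y). (ract M g x, ract N g y))"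
  F "bilinear_rels M N" s "\<lambda>g p. s (\<chi> g) (\<theta> g p)" eval
  by unfold_locales (use subspace_F rels_eq eval_add eval_scale free_map_eval in auto)

lemma realizes_tensor: "realizes G (tensor_rep M N) s (\<lambda>g p. s (\<chi> g) (\<theta> g p)) tensor.val"
  unfolding tensor_rep_def by (rule tensor.realizes_quot)

lemma tensor_val_image: "tensor.val ` elems (tensor_rep M N) = \<beta> ` elems N"
proof -
  note n = realizesD[OF N]
  have "eval ` F = \<beta> ` elems N"
  proof
    show "eval ` F \<subseteq> \<beta> ` elems N"
    proof clarify
      fix f assume f: "f \<in> F"
      obtain y where y: "y \<in> elems N" "f - basis_vec (\<kappa>, y) \<in> bilinear_rels M N"
        using mod_rels_simple f by blast
      have "eval f = \<beta> y"
        using rels_sub[OF y(2)] eval_diff[OF f basis_mem] y \<kappa> by (auto simp: eval_basis)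
      then show "eval f \<in> \<beta> ` elems N" using y by blast
    qed
    have "\<beta> y = eval (basis_vec (\<kappa>, y))" for y using \<kappa> by (simp add: eval_basis)
    then show "\<beta> ` elems N \<subseteq> eval ` F" using basis_mem \<kappa> by auto
  qed
  then show ?thesis unfolding tensor_rep_def tensor.val_image .
qed

end

section \<open>Substitution homomorphisms\<close>

lemma poly_mapping_eq_sum_single:
  "p = (\<Sum>m\<in>Poly_Mapping.keys p. Poly_Mapping.single m (Poly_Mapping.lookup p m))"
proof (rule poly_mapping_eqI)
  fix m
  have "Poly_Mapping.lookup (\<Sum>m\<in>Poly_Mapping.keys p. Poly_Mapping.single m (Poly_Mapping.lookup p m)) m
      = (\<Sum>m'\<in>Poly_Mapping.keys p. if m' = m then Poly_Mapping.lookup p m' else 0)"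
    by (simp add: Poly_Mapping.lookup_sum Poly_Mapping.lookup_single when_def)
  then show "Poly_Mapping.lookup p m = Poly_Mapping.lookup (\<Sum>m\<in>Poly_Mapping.keys p. Poly_Mapping.single m (Poly_Mapping.lookup p m)) m"
    by (simp add: Poly_Mapping.in_keys_iff)
qed

interpretation zconst: comm_ring_hom "zconst :: 'k::comm_ring_1 \<Rightarrow> 'k zpoly"
  by unfold_locales (simp_all add: zconst_def single_add mult_single)

definition subst_monom :: "(nat \<times> nat \<Rightarrow> 'k::comm_ring_1 zpoly) \<Rightarrow> (nat \<times> nat \<Rightarrow>\<^sub>0 nat) \<Rightarrow> 'k zpoly"
  where "subst_monom \<sigma> m = (\<Prod>x\<in>Poly_Mapping.keys m. \<sigma> x ^ Poly_Mapping.lookup m x)"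

definition subst :: "(nat \<times> nat \<Rightarrow> 'k::comm_ring_1 zpoly) \<Rightarrow> 'k zpoly \<Rightarrow> 'k zpoly" where
  "subst \<sigma> p = (\<Sum>m\<in>Poly_Mapping.keys p. zconst (Poly_Mapping.lookup p m) * subst_monom \<sigma> m)"

lemma subst_monom_add: "subst_monom \<sigma> (m + m') = subst_monom \<sigma> m * subst_monom \<sigma> m'"
proof -
  let ?S = "Poly_Mapping.keys m \<union> Poly_Mapping.keys m'"
  have "subst_monom \<sigma> l = (\<Prod>x\<in>?S. \<sigma> x ^ Poly_Mapping.lookup l x)" if "Poly_Mapping.keys l \<subseteq> ?S" for l
    unfolding subst_monom_def by (rule prod.mono_neutral_left) (use that in \<open>auto simp: Poly_Mapping.in_keys_iff\<close>)
  from this[of "m + m'"] this[of m] this[of m'] show ?thesis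
    using Poly_Mapping.keys_add[of m m'] by (simp add: Poly_Mapping.lookup_add power_add prod.distrib)
qed

lemma subst_add: "subst \<sigma> (p + q) = subst \<sigma> p + subst \<sigma> q"
proof -
  let ?S = "Poly_Mapping.keys p \<union> Poly_Mapping.keys q"
  have "subst \<sigma> r = (\<Sum>m\<in>?S. zconst (Poly_Mapping.lookup r m) * subst_monom \<sigma> m)" if "Poly_Mapping.keys r \<subseteq> ?S" for r
    unfolding subst_def by (rule sum.mono_neutral_left) (use that in \<open>auto simp: Poly_Mapping.in_keys_iff\<close>)
  from this[of "p + q"] this[of p] this[of q] show ?thesis
    using Poly_Mapping.keys_add[of p q]
    by (simp add: Poly_Mapping.lookup_add zconst.hom_add algebra_simps sum.distrib)
qed

lemma subst_single: "subst \<sigma> (Poly_Mapping.single m c) = zconst c * subst_monom \<sigma> m"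
  by (simp add: subst_def)

lemma subst_zero: "subst \<sigma> 0 = 0"
  by (simp add: subst_def)

lemma subst_sum: "subst \<sigma> (sum f A) = (\<Sum>a\<in>A. subst \<sigma> (f a))"
  by (induction A rule: infinite_finite_induct) (auto simp: subst_add subst_zero)

lemma subst_mult: "subst \<sigma> (p * q) = subst \<sigma> p * subst \<sigma> q"
proof -
  have "p * q = (\<Sum>m\<in>Poly_Mapping.keys p. Poly_Mapping.single m (Poly_Mapping.lookup p m)) *
      (\<Sum>l\<in>Poly_Mapping.keys q. Poly_Mapping.single l (Poly_Mapping.lookup q l))"
    by (simp only: poly_mapping_eq_sum_single[symmetric])
  also have "\<dots> = (\<Sum>m\<in>Poly_Mapping.keys p. \<Sum>l\<in>Poly_Mapping.keys q. Poly_Mapping.single (m + l) (Poly_Mapping.lookup p m * Poly_Mapping.lookup q l))"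
    by (simp add: sum_product mult_single)
  finally show ?thesis
    by (simp add: subst_sum subst_single subst_monom_add sum_product zconst.hom_mult mult_ac)
      (simp add: subst_def sum_product mult_ac)
qed

lemma subst_monom_0: "subst_monom \<sigma> 0 = 1"
  by (simp add: subst_monom_def)

lemma subst_zconst: "subst \<sigma> (zconst c) = zconst c"
  by (simp add: zconst_def subst_single subst_monom_0)

lemma subst_generic: "subst \<sigma> (generic_matrix p q) = \<sigma> (p, q)"
  by (simp add: generic_matrix_def subst_single subst_monom_def)

lemma comm_ring_hom_subst: "comm_ring_hom (subst \<sigma>)"
  by unfold_locales (use subst_zconst[of \<sigma> 1] in \<open>simp_all add: subst_add subst_mult subst_zero\<close>)

text \<open>A variable is no zero divisor over any commutative ring, with or without zero divisors
  in it: multiplication by it only shifts exponents, which is injective on monomials.\<close>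

lemma generic_mult_cancel:
  assumes "generic_matrix p q * P = 0" shows "P = 0"
proof (rule poly_mapping_eqI)
  fix m
  let ?e = "Poly_Mapping.single (p, q) 1 :: nat \<times> nat \<Rightarrow>\<^sub>0 nat"
  have "generic_matrix p q * P = generic_matrix p q * (\<Sum>m\<in>Poly_Mapping.keys P. Poly_Mapping.single m (Poly_Mapping.lookup P m))"
    by (simp only: poly_mapping_eq_sum_single[symmetric])
  also have "\<dots> = (\<Sum>m\<in>Poly_Mapping.keys P. Poly_Mapping.single (?e + m) (Poly_Mapping.lookup P m))"
    by (simp add: generic_matrix_def sum_distrib_left mult_single)
  finally have "Poly_Mapping.lookup (generic_matrix p q * P) (?e + m)
      = (\<Sum>m'\<in>Poly_Mapping.keys P. if m' = m then Poly_Mapping.lookup P m' else 0)"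
    by (simp add: Poly_Mapping.lookup_sum Poly_Mapping.lookup_single when_def)
  then show "Poly_Mapping.lookup P m = Poly_Mapping.lookup 0 m" by (simp add: assms Poly_Mapping.in_keys_iff split: if_splits)
qed

section \<open>Determinants\<close>

text \<open>By the pigeonhole principle every permutation sends some row of \<open>R\<close> to a
  column of \<open>C\<close>, so each term of the Leibniz formula contains a zero entry.\<close>

lemma det_zero_block:
  fixes A :: "'a::comm_ring_1 mat"
  assumes A: "A \<in> carrier_mat n n" and R: "R \<subseteq> {0..<n}" and C: "C \<subseteq> {0..<n}"
    and big: "n < card R + card C" and zero: "\<And>i j. i \<in> R \<Longrightarrow> j \<in> C \<Longrightarrow> A $$ (i, j) = 0"
  shows "det A = 0"
proof -
  have "(\<Prod>i = 0..<n. A $$ (i, \<pi> i)) = 0" if \<pi>: "\<pi> permutes {0..<n}" for \<pi>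
  proof -
    have "\<exists>i\<in>R. \<pi> i \<in> C"
    proof (rule ccontr)
      assume "\<not> ?thesis"
      then have "\<pi> ` R \<subseteq> {0..<n} - C" using permutes_in_image[OF \<pi>] R by auto
      then have "card (\<pi> ` R) \<le> n - card C"
        using card_mono[of "{0..<n} - C" "\<pi> ` R"] card_Diff_subset[of C "{0..<n}"] C
          finite_subset[OF C] by simp
      moreover have "card (\<pi> ` R) = card R"
        by (intro card_image inj_on_subset[OF permutes_inj[OF \<pi>]]) simp
      moreover have "card C \<le> n" using card_mono[OF _ C] by simp
      ultimately show False using big by simp
    qed
    then obtain i where "i \<in> R" "\<pi> i \<in> C" by blast
    then show ?thesis using zero R by (intro prod_zero) auto
  qed
  then show ?thesis unfolding det_def'[OF A] by simp
qed

section \<open>The Cauchy-Binet formula\<close>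

lemma bij_betw_nth_sorted: "finite b \<Longrightarrow> bij_betw ((!) (sorted_list_of_set b)) {0..<card b} b"
  by (rule bij_betw_nth) auto

lemma enumerations_eq:
  assumes "finite S" "b \<subseteq> S" and r: "card b = r"
  shows "{f \<in> {0..<r} \<rightarrow>\<^sub>E S. inj_on f {0..<r} \<and> f ` {0..<r} = b}
     = (\<lambda>\<pi>. \<lambda>i\<in>{0..<r}. sorted_list_of_set b ! \<pi> i) ` {\<pi>. \<pi> permutes {0..<r}}"
    (is "?L = ?h ` ?P")
proof
  have "finite b" using assms finite_subset by blast
  note nth = bij_betw_nth_sorted[OF this, unfolded r]
  show "?h ` ?P \<subseteq> ?L"
  proof clarify
    fix \<pi> assume \<pi>: "\<pi> permutes {0..<r}"
    have "bij_betw ((!) (sorted_list_of_set b) \<circ> \<pi>) {0..<r} b"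
      by (rule bij_betw_trans[OF permutes_imp_bij[OF \<pi>] nth])
    then have "bij_betw (?h \<pi>) {0..<r} b" by (rule bij_betw_cong[THEN iffD1, rotated]) simp
    then show "?h \<pi> \<in> {0..<r} \<rightarrow>\<^sub>E S \<and> inj_on (?h \<pi>) {0..<r} \<and> ?h \<pi> ` {0..<r} = b"
      using assms(2) unfolding bij_betw_def by auto
  qed
  show "?L \<subseteq> ?h ` ?P"
  proof
    fix f assume "f \<in> ?L"
    then have f: "f \<in> {0..<r} \<rightarrow>\<^sub>E S" "inj_on f {0..<r}" "f ` {0..<r} = b" by auto
    \<comment> \<open>The position of \<open>f i\<close> in the increasing enumeration of
      \<open>b\<close>, continued by the identity so that it is a permutation.\<close>
    define \<pi> where
      "\<pi> i = (if i \<in> {0..<r} then inv_into {0..<r} ((!) (sorted_list_of_set b)) (f i) else i)" for i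
    have "bij_betw f {0..<r} b" using f by (simp add: bij_betw_def)
    from bij_betw_trans[OF this bij_betw_inv_into[OF nth]]
    have "bij_betw \<pi> {0..<r} {0..<r}"
      by (rule bij_betw_cong[THEN iffD1, rotated]) (simp add: \<pi>_def)
    then have perm: "\<pi> permutes {0..<r}" by (rule bij_imp_permutes) (simp add: \<pi>_def)
    have eq: "f = ?h \<pi>"
    proof
      fix i
      show "f i = ?h \<pi> i"
      proof (cases "i \<in> {0..<r}")
        case True
        then have "f i \<in> (!) (sorted_list_of_set b) ` {0..<r}"
          using f(3) nth by (auto simp: bij_betw_def)
        from f_inv_into_f[OF this] True show ?thesis by (simp add: \<pi>_def)
      next
        case False
        with PiE_arb[OF f(1) False] show ?thesis by (simp only: restrict_def if_False)
      qed
    qed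
    have "?h \<pi> \<in> ?h ` ?P" by (rule imageI) (use perm in simp)
    then show "f \<in> ?h ` ?P" by (subst eq)
  qed
qed

text \<open>The determinant on the right is expanded over all choice functions \<open>f\<close> of
  summation indices. Those that are not injective give a repeated row; the others are grouped by
  their image \<open>b\<close>. The entry \<open>A j q * B i q\<close> has this transposed form
  because rows will stand for boxes and columns for vectors.\<close>

lemma cauchy_binet:
  fixes A B :: "nat \<Rightarrow> nat \<Rightarrow> 'a::comm_ring_1"
  assumes S: "finite S"
  shows "(\<Sum>b | b \<subseteq> S \<and> card b = r.
      det (mat r r (\<lambda>(i, j). A i (sorted_list_of_set b ! j)))
    * det (mat r r (\<lambda>(i, j). B i (sorted_list_of_set b ! j))))
   = det (mat r r (\<lambda>(i, j). \<Sum>q\<in>S. A j q * B i q))" (is "?L = ?R")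
proof -
  let ?P = "{\<pi>. \<pi> permutes {0..<r}}"
  let ?F = "{0..<r} \<rightarrow>\<^sub>E S"
  define dA where "dA f = det (mat r r (\<lambda>(i, j). A j (f i)))" for f
  let ?t = "\<lambda>f. dA f * (\<Prod>i = 0..<r. B i (f i))"
  have finF: "finite ?F" using S by (intro finite_PiE) auto
  have "?R = (\<Sum>\<pi>\<in>?P. signof \<pi> * (\<Prod>i = 0..<r. \<Sum>q\<in>S. A (\<pi> i) q * B i q))"
    by (subst det_def'[of _ r]) (auto intro!: sum.cong prod.cong simp: permutes_in_image)
  also have "\<dots> = (\<Sum>\<pi>\<in>?P. \<Sum>f\<in>?F. signof \<pi> * ((\<Prod>i = 0..<r. A (\<pi> i) (f i)) * (\<Prod>i = 0..<r. B i (f i))))"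
    by (subst prod_sum_PiE) (use S in \<open>auto simp: sum_distrib_left prod.distrib\<close>)
  also have "\<dots> = (\<Sum>f\<in>?F. \<Sum>\<pi>\<in>?P. signof \<pi> * ((\<Prod>i = 0..<r. A (\<pi> i) (f i)) * (\<Prod>i = 0..<r. B i (f i))))"
    by (rule sum.swap)
  also have "\<dots> = (\<Sum>f\<in>?F. ?t f)"
  proof (rule sum.cong[OF refl])
    fix f
    have "dA f = (\<Sum>\<pi>\<in>?P. signof \<pi> * (\<Prod>i = 0..<r. A (\<pi> i) (f i)))"
      unfolding dA_def by (subst det_def'[of _ r]) (auto intro!: sum.cong prod.cong simp: permutes_in_image)
    then show "(\<Sum>\<pi>\<in>?P. signof \<pi> * ((\<Prod>i = 0..<r. A (\<pi> i) (f i)) * (\<Prod>i = 0..<r. B i (f i)))) = ?t f"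
      by (simp add: sum_distrib_right mult.assoc)
  qed
  also have "\<dots> = (\<Sum>f\<in>{f \<in> ?F. inj_on f {0..<r}}. ?t f)"
  proof (rule sum.mono_neutral_right[OF finF])
    show "\<forall>f\<in>?F - {f \<in> ?F. inj_on f {0..<r}}. ?t f = 0"
    proof
      fix f assume "f \<in> ?F - {f \<in> ?F. inj_on f {0..<r}}"
      then obtain i j where ij: "i < r" "j < r" "i \<noteq> j" "f i = f j"
        by (auto simp: inj_on_def)
      have "dA f = 0" unfolding dA_def
        by (rule det_identical_rows[OF _ ij(3,1,2)]) (use ij in \<open>auto intro!: eq_vecI\<close>)
      then show "?t f = 0" by simp
    qed
  qed auto
  also have "\<dots> = (\<Sum>b | b \<subseteq> S \<and> card b = r.
      \<Sum>f\<in>{f \<in> {f \<in> ?F. inj_on f {0..<r}}. f ` {0..<r} = b}. ?t f)"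
  proof (rule sum.group[symmetric])
    show "finite {f \<in> ?F. inj_on f {0..<r}}" using finF by simp
    show "finite {b. b \<subseteq> S \<and> card b = r}" using S by simp
    show "(\<lambda>f. f ` {0..<r}) ` {f \<in> ?F. inj_on f {0..<r}} \<subseteq> {b. b \<subseteq> S \<and> card b = r}"
      by (auto simp: card_image)
  qed
  also have "\<dots> = ?L"
  proof (rule sum.cong[OF refl])
    fix b assume "b \<in> {b. b \<subseteq> S \<and> card b = r}"
    then have b: "b \<subseteq> S" "card b = r" by auto
    let ?b = "\<lambda>i. sorted_list_of_set b ! i"
    let ?h = "\<lambda>\<pi>. \<lambda>i\<in>{0..<r}. ?b (\<pi> i)"
    have finb: "finite b" using b S finite_subset by blast
    note nth = bij_betw_nth_sorted[OF finb, unfolded b(2)]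
    have E: "{f \<in> {f \<in> ?F. inj_on f {0..<r}}. f ` {0..<r} = b} = ?h ` ?P"
      by (subst enumerations_eq[OF S b, symmetric]) auto
    have inj: "inj_on ?h ?P"
    proof (rule inj_onI, rule ext)
      fix \<pi> \<rho> i assume p: "\<pi> \<in> ?P" "\<rho> \<in> ?P" and eq: "?h \<pi> = ?h \<rho>"
      show "\<pi> i = \<rho> i"
      proof (cases "i \<in> {0..<r}")
        case True
        then have "?b (\<pi> i) = ?b (\<rho> i)" using fun_cong[OF eq, of i] by simp
        then show ?thesis
          by (rule inj_onD[OF bij_betw_imp_inj_on[OF nth]])
            (use True p permutes_in_image[of \<pi> "{0..<r}" i] permutes_in_image[of \<rho> "{0..<r}" i] in simp_all)
      next
        case False
        then show ?thesis using p by (simp add: permutes_def)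
      qed
    qed
    \<comment> \<open>Sorting the rows on the side of \<open>A\<close> costs the sign of \<pi>,
      which is the sign that the Leibniz formula on the side of \<open>B\<close> needs.\<close>
    have "?t (?h \<pi>) = dA ?b * (signof \<pi> * (\<Prod>i = 0..<r. B i (?b (\<pi> i))))" if \<pi>: "\<pi> permutes {0..<r}" for \<pi>
    proof -
      let ?M = "mat r r (\<lambda>(i, j). A j (?b i))"
      have "dA (?h \<pi>) = det (mat r r (\<lambda>(i, j). ?M $$ (\<pi> i, j)))"
        unfolding dA_def
        by (rule arg_cong[of _ _ det], rule eq_matI) (use permutes_in_image[OF \<pi>] in auto)
      also have "\<dots> = signof \<pi> * dA ?b"
        unfolding dA_def by (rule det_permute_rows[OF _ \<pi>]) simp
      finally show ?thesis by simp
    qed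
    then have "(\<Sum>f\<in>?h ` ?P. ?t f) = dA ?b * (\<Sum>\<pi>\<in>?P. signof \<pi> * (\<Prod>i = 0..<r. B i (?b (\<pi> i))))"
      by (simp add: sum.reindex[OF inj] sum_distrib_left)
    also have "dA ?b = det (transpose_mat (mat r r (\<lambda>(i, j). A i (?b j))))"
      unfolding dA_def by (rule arg_cong[of _ _ det], rule eq_matI) auto
    also have "\<dots> = det (mat r r (\<lambda>(i, j). A i (?b j)))"
      by (rule det_transpose[of _ r]) simp
    also have "(\<Sum>\<pi>\<in>?P. signof \<pi> * (\<Prod>i = 0..<r. B i (?b (\<pi> i)))) = det (mat r r (\<lambda>(i, j). B i (?b j)))"
      by (subst det_def'[of _ r]) (auto intro!: sum.cong prod.cong simp: permutes_in_image)
    finally show "(\<Sum>f\<in>{f \<in> {f \<in> ?F. inj_on f {0..<r}}. f ` {0..<r} = b}. ?t f)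
      = det (mat r r (\<lambda>(i, j). A i (?b j))) * det (mat r r (\<lambda>(i, j). B i (?b j)))"
      unfolding E .
  qed
  finally show ?thesis ..
qed

section \<open>Minors and wedge products\<close>

text \<open>Row \<open>p\<close> of \<open>Z\<close> as a linear form on \<open>E\<close>. It lets
  minors be taken at arbitrary vectors instead of basis vectors.\<close>

definition row_apply :: "(nat \<Rightarrow> nat \<Rightarrow> 'k zpoly) \<Rightarrow> nat \<Rightarrow> nat \<Rightarrow> 'k vec_E \<Rightarrow> 'k::comm_ring_1 zpoly" where
  "row_apply Z n p v = (\<Sum>q\<in>{1..n}. zconst (v q) * Z p q)"

definition wedge_mat :: "(nat \<Rightarrow> nat \<Rightarrow> 'k zpoly) \<Rightarrow> nat \<Rightarrow> nat set \<Rightarrow> 'k vec_E list \<Rightarrow> 'k::comm_ring_1 zpoly mat"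
  where "wedge_mat Z n a vs =
    mat (card a) (card a) (\<lambda>(i, j). row_apply Z n (sorted_list_of_set a ! i) (vs ! j))"

definition wedge_minor :: "(nat \<Rightarrow> nat \<Rightarrow> 'k zpoly) \<Rightarrow> nat \<Rightarrow> nat set \<Rightarrow> 'k vec_E list \<Rightarrow> 'k::comm_ring_1 zpoly"
  where "wedge_minor Z n a vs = det (wedge_mat Z n a vs)"

lemma wedge_mat_carrier [simp]: "wedge_mat Z n a vs \<in> carrier_mat (card a) (card a)"
  by (simp add: wedge_mat_def)

lemma row_apply_basis_vec: "q \<in> {1..n} \<Longrightarrow> row_apply Z n p (basis_vec q) = Z p q"
proof -
  have "zconst (basis_vec q q') * Z p q' = (if q' = q then Z p q' else 0)" for q'
    by (simp add: basis_vec_def)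
  then show "q \<in> {1..n} \<Longrightarrow> ?thesis" by (simp add: row_apply_def)
qed

text \<open>Cauchy-Binet for the coordinate matrix of the vectors and the rows \<open>a\<close> of
  \<open>Z\<close>: the linear form \<open>z_b \<mapsto> \<Delta>_{a,b}\<close> takes a wedge
  product to a single determinant.\<close>

lemma sum_wedge_coeff_minor:
  assumes "length vs = card a"
  shows "(\<Sum>b | b \<subseteq> {1..n} \<and> card b = card a. zconst (wedge_coeff vs b) * minor Z a b)
    = wedge_minor Z n a vs"
proof -
  let ?r = "card a"
  have 1: "zconst (wedge_coeff vs b) = det (mat ?r ?r (\<lambda>(i, j). zconst ((vs ! i) (sorted_list_of_set b ! j))))" for b
    unfolding wedge_coeff_def zconst.hom_det[symmetric] assms
    by (rule arg_cong[of _ _ det], rule eq_matI) auto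
  have 2: "minor Z a b = det (mat ?r ?r (\<lambda>(i, j). Z (sorted_list_of_set a ! i) (sorted_list_of_set b ! j)))" for b
    by (simp add: minor_def)
  show ?thesis
    unfolding 1 2 wedge_minor_def wedge_mat_def row_apply_def
    by (rule cauchy_binet[of "{1..n}" ?r "\<lambda>i q. zconst ((vs ! i) q)"
        "\<lambda>i q. Z (sorted_list_of_set a ! i) q", OF finite_atLeastAtMost])
qed

section \<open>Products of minors over the columns of a diagram\<close>

text \<open>The columns of a tableau are chosen independently, so this is distributivity.\<close>

lemma sum_tableaux_prod:
  fixes f :: "nat \<Rightarrow> nat set \<Rightarrow> 'a::comm_ring_1"
  shows "(\<Sum>\<tau>\<in>tableaux n D. \<Prod>j<length D. f j (\<tau> ! j))
    = (\<Prod>j<length D. \<Sum>b | b \<subseteq> {1..n} \<and> card b = card (D ! j). f j b)"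
proof -
  let ?B = "\<lambda>j. {b. b \<subseteq> {1..n} \<and> card b = card (D ! j)}"
  have "(\<Prod>j<length D. \<Sum>b\<in>?B j. f j b) = (\<Sum>g\<in>PiE {..<length D} ?B. \<Prod>j<length D. f j (g j))"
    by (rule prod_sum_PiE) auto
  also have "\<dots> = (\<Sum>\<tau>\<in>tableaux n D. \<Prod>j<length D. f j (\<tau> ! j))"
  proof (rule sum.reindex_bij_witness[where i = "\<lambda>\<tau>. \<lambda>j\<in>{..<length D}. \<tau> ! j"
        and j = "\<lambda>g. map g [0..<length D]"], goal_cases)
    case (1 g) then show ?case by (auto simp: fun_eq_iff PiE_def extensional_def)
  next
    case (2 g) then show ?case by (auto simp: tableaux_def PiE_def Pi_def)
  next
    case (3 \<tau>) then show ?case by (auto intro!: nth_equalityI simp: tableaux_def)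
  next
    case (4 \<tau>) then show ?case by (auto simp: tableaux_def)
  next
    case (5 g) then show ?case by simp
  qed
  finally show ?thesis ..
qed

lemma minors_map_add: "minors_map Z n D (x + y) = minors_map Z n D x + minors_map Z n D y"
  by (simp add: minors_map_def zconst.hom_add algebra_simps sum.distrib)

lemma minors_map_zero: "minors_map Z n D 0 = 0"
  by (simp add: minors_map_def)

lemma minors_map_scale: "minors_map Z n D (fscale c x) = zconst c * minors_map Z n D x"
  by (simp add: minors_map_def fscale_def zconst.hom_mult sum_distrib_left mult.assoc)

lemma minors_map_sum: "minors_map Z n D (sum f A) = (\<Sum>a\<in>A. minors_map Z n D (f a))"
  by (induction A rule: infinite_finite_induct)
     (simp_all only: sum.infinite sum.empty sum.insert minors_map_add minors_map_zero not_False_eq_True)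

lemma minors_map_tensor_of_wedges:
  assumes "\<And>j. j < length D \<Longrightarrow> length (vss ! j) = card (D ! j)"
  shows "minors_map Z n D (tensor_of_wedges n D vss) = (\<Prod>j<length D. wedge_minor Z n (D ! j) (vss ! j))"
proof -
  have "minors_map Z n D (tensor_of_wedges n D vss) = (\<Sum>\<tau>\<in>tableaux n D.
      \<Prod>j<length D. zconst (wedge_coeff (vss ! j) (\<tau> ! j)) * minor Z (D ! j) (\<tau> ! j))"
    unfolding minors_map_def by (rule sum.cong) (auto simp: tensor_of_wedges_def zconst.hom_prod prod.distrib)
  also have "\<dots> = (\<Prod>j<length D. wedge_minor Z n (D ! j) (vss ! j))"
    by (subst sum_tableaux_prod[of "\<lambda>j b. zconst (wedge_coeff (vss ! j) b) * minor Z (D ! j) b"])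
       (rule prod.cong[OF refl], rule sum_wedge_coeff_minor, simp add: assms)
  finally show ?thesis .
qed

lemma tableauxD:
  assumes "\<tau> \<in> tableaux n D"
  shows "length \<tau> = length D"
    "j < length D \<Longrightarrow> \<tau> ! j \<subseteq> {1..n}" "j < length D \<Longrightarrow> card (\<tau> ! j) = card (D ! j)"
    "j < length D \<Longrightarrow> finite (\<tau> ! j)"
  using assms finite_subset[of "\<tau> ! j" "{1..n}"] by (auto simp: tableaux_def)

lemma minor_cong:
  assumes "\<And>p q. p \<in> a \<Longrightarrow> q \<in> b \<Longrightarrow> Z p q = Z' p q" "card b = card a"
  shows "minor Z a b = minor Z' a b"
proof -
  \<comment> \<open>Infinite sets have cardinality 0, so the assumption on \<open>i\<close> includes
    finiteness.\<close>
  have mem: "sorted_list_of_set c ! i \<in> c" if "i < card c" for c :: "nat set" and i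
    using that by (metis card.infinite length_sorted_list_of_set not_less_zero nth_mem set_sorted_list_of_set)
  show ?thesis
    unfolding minor_def
    by (rule arg_cong[of _ _ det], rule eq_matI) (use assms mem in auto)
qed

lemma minors_map_cong:
  assumes "\<And>p q. q \<in> {1..n} \<Longrightarrow> Z p q = Z' p q"
  shows "minors_map Z n D = minors_map Z' n D"
proof
  fix x
  show "minors_map Z n D x = minors_map Z' n D x"
    unfolding minors_map_def
    by (intro sum.cong prod.cong refl arg_cong2[of _ _ _ _ "(*)"] minor_cong)
       (use assms tableauxD in \<open>auto dest: tableauxD(2)[THEN subsetD]\<close>)
qed

lemma wedge_minor_map:
  assumes "card b = card a"
  shows "wedge_minor Z n a (map f (sorted_list_of_set b)) = minor (\<lambda>p q. row_apply Z n p (f q)) a b"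
  unfolding wedge_minor_def wedge_mat_def minor_def
  by (rule arg_cong[of _ _ det], rule eq_matI) (use assms in auto)

lemma tensor_of_wedges_mem: "tensor_of_wedges n D vss \<in> TE n D"
  by (simp add: tensor_of_wedges_def TE_def)

lemma subspace_TE: "fscale.subspace (TE n D)"
  by (auto simp: fscale.subspace_def TE_def fscale_def)

lemma act_TE_mem: "act_TE n D g x \<in> TE n D"
  unfolding act_TE_def
  by (intro fscale.subspace_sum[OF subspace_TE] fscale.subspace_scale[OF subspace_TE] tensor_of_wedges_mem)

lemma minors_map_act_TE:
  "minors_map Z n D (act_TE n D g x)
    = minors_map (\<lambda>p q. row_apply Z n p (apply_E n g (basis_vec q))) n D x"
proof -
  let ?w = "\<lambda>\<tau>. map (\<lambda>b. map (\<lambda>q. apply_E n g (basis_vec q)) (sorted_list_of_set b)) \<tau>"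
  have "minors_map Z n D (tensor_of_wedges n D (?w \<tau>))
    = (\<Prod>j<length D. minor (\<lambda>p q. row_apply Z n p (apply_E n g (basis_vec q))) (D ! j) (\<tau> ! j))"
    if \<tau>: "\<tau> \<in> tableaux n D" for \<tau>
    by (subst minors_map_tensor_of_wedges) (use tableauxD[OF \<tau>] in \<open>auto simp: wedge_minor_map\<close>)
  then show ?thesis
    unfolding act_TE_def minors_map_sum minors_map_scale
    by (subst minors_map_def) (rule sum.cong; simp)
qed

text \<open>Minors are polynomials in the entries, so a homomorphism fixing the constants may be
  applied to the matrix instead. This serves for specialising the generic matrix, for the group
  action and for the row swap.\<close>

lemma minors_map_hom:
  assumes "comm_ring_hom h" "\<And>c. h (zconst c) = zconst c"
  shows "h (minors_map Z n D x) = minors_map (\<lambda>p q. h (Z p q)) n D x"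
proof -
  interpret comm_ring_hom h by fact
  have "h (minor Z a b) = minor (\<lambda>p q. h (Z p q)) a b" for a b
    unfolding minor_def hom_det[symmetric] by (rule arg_cong[of _ _ det], rule eq_matI) auto
  then show ?thesis by (simp add: minors_map_def hom_sum hom_mult hom_prod assms(2))
qed

section \<open>Exchange relations between two columns\<close>

text \<open>This is the entry at \<open>(i, t)\<close> of \<open>A\<close> times its adjugate. For
  \<open>i \<noteq> t\<close> it is the expansion of a determinant with a repeated row.\<close>

lemma sum_row_cofactor:
  fixes A :: "'a::comm_ring_1 mat"
  assumes A: "A \<in> carrier_mat n n" and "i < n" "t < n"
  shows "(\<Sum>q<n. A $$ (i, q) * cofactor A t q) = (if i = t then det A else 0)"
proof -
  have "(A * adj_mat A) $$ (i, t) = (\<Sum>q<n. A $$ (i, q) * cofactor A t q)"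
    using assms by (simp add: scalar_prod_def adj_mat_def lessThan_atLeast0)
  then show ?thesis using assms adj_mat(2)[OF A] by auto
qed

lemma cofactor_cong:
  assumes "dim_row A = dim_row B" "dim_col A = dim_col B"
    and "\<And>i j. i < dim_row A \<Longrightarrow> j < dim_col A \<Longrightarrow> i \<noteq> t \<Longrightarrow> j \<noteq> l \<Longrightarrow> A $$ (i, j) = B $$ (i, j)"
  shows "cofactor A t l = cofactor B t l"
proof -
  have "mat_delete A t l = mat_delete B t l"
    unfolding mat_delete_def assms(1,2)
    by (rule eq_matI) (use assms in auto)
  then show ?thesis by (simp add: cofactor_def)
qed

text \<open>Deleting a row from \<open>i\<close> on and a column before \<open>i\<close> leaves the
  whole zero block of \<open>i\<close> rows and \<open>r - i\<close> columns in a matrix of size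
  \<open>r - 1\<close>.\<close>

lemma cofactor_zero_block:
  fixes A :: "'a::comm_ring_1 mat"
  assumes A: "A \<in> carrier_mat r r" and zero: "\<And>i' l'. i' < i \<Longrightarrow> i \<le> l' \<Longrightarrow> l' < r \<Longrightarrow> A $$ (i', l') = 0"
    and tl: "i \<le> t" "t < r" "l < i"
  shows "cofactor A t l = 0"
proof -
  have "det (mat_delete A t l) = 0"
  proof (rule det_zero_block[of _ "r - 1" "{0..<i}" "{i - 1..<r - 1}"])
    show "mat_delete A t l \<in> carrier_mat (r - 1) (r - 1)" using mat_delete_carrier[OF A] .
    show "r - 1 < card {0..<i} + card {i - 1..<r - 1}" using tl by simp
    fix i' l' assume "i' \<in> {0..<i}" "l' \<in> {i - 1..<r - 1}"
    then show "mat_delete A t l $$ (i', l') = 0"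
      using A tl zero[of i' "Suc l'"] by (auto simp: mat_delete_def)
  qed (use tl in auto)
  then show ?thesis by (simp add: cofactor_def)
qed

section \<open>Expansions of minors of a column with bottom box \<open>k\<close>\<close>

lemma sorted_list_of_set_snoc:
  assumes "finite a" "a \<noteq> {}" "Max a = k"
  shows "sorted_list_of_set a = sorted_list_of_set (a - {k}) @ [k]"
proof (rule sorted_distinct_set_unique)
  have "k \<in> a" "\<And>x. x \<in> a \<Longrightarrow> x \<le> k" 
    using Max_in[OF assms(1,2)] Max_ge[OF assms(1)] assms(3) by simp_all
  then show "sorted (sorted_list_of_set (a - {k}) @ [k])" "distinct (sorted_list_of_set (a - {k}) @ [k])"
    "set (sorted_list_of_set a) = set (sorted_list_of_set (a - {k}) @ [k])"
    using assms(1) by (auto simp: sorted_append)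
qed auto

lemma mat_delete_wedge_mat_last:
  assumes a: "finite a" "a \<noteq> {}" "Max a = k" and w: "length w = card a" and p: "p < card a"
  shows "mat_delete (wedge_mat Z n a w) (card a - 1) p = wedge_mat Z n (a - {k}) (take p w @ drop (Suc p) w)"
proof -
  have k: "k \<in> a" using Max_in[OF a(1,2)] a(3) by simp
  have c: "card (a - {k}) = card a - 1" using a k by simp
  obtain L where L: "sorted_list_of_set (a - {k}) = L" "sorted_list_of_set a = L @ [k]" "length L = card a - 1"
    using sorted_list_of_set_snoc[OF a] c by (metis length_sorted_list_of_set)
  show ?thesis
    unfolding mat_delete_def wedge_mat_def
    by (rule eq_matI)
       (use p w in \<open>auto simp: c L nth_append min_def\<close>)
qed

text \<open>In the Laplace expansion along the last column only the bottom entry survives, and the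
  bottom row belongs to the box \<open>k\<close>.\<close>

lemma wedge_minor_last_column:
  assumes a: "finite a" "a \<noteq> {}" "Max a = k" and vs: "length vs = card a"
    and zero: "\<And>p. p \<in> a \<Longrightarrow> p \<noteq> k \<Longrightarrow> row_apply Z n p (last vs) = 0"
  shows "wedge_minor Z n a vs = row_apply Z n k (last vs) * wedge_minor Z n (a - {k}) (butlast vs)"
proof -
  let ?A = "wedge_mat Z n a vs" and ?r = "card a"
  let ?i = "?r - 1"
  have k: "k \<in> a" using Max_in[OF a(1,2)] a(3) by simp
  have r: "?r > 0" using a by (simp add: card_gt_0_iff)
  have c: "card (a - {k}) = ?r - 1" using a k by simp
  obtain L where L: "sorted_list_of_set (a - {k}) = L" "sorted_list_of_set a = L @ [k]" "length L = card a - 1"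
    using sorted_list_of_set_snoc[OF a] c by (metis length_sorted_list_of_set)
  have "vs \<noteq> []" using vs r by auto
  then have last: "vs ! ?i = last vs" by (simp add: last_conv_nth vs)
  have z: "?A $$ (i, ?i) = (if i = ?i then row_apply Z n k (last vs) else 0)" if "i < ?r" for i
  proof (cases "i = ?i")
    case True
    then show ?thesis using r last by (auto simp: wedge_mat_def L nth_append c)
  next
    case False
    then have "L ! i \<in> set L" using that L(3) by simp
    also have "set L = a - {k}" using a(1) L(1) by (metis finite_Diff set_sorted_list_of_set)
    finally have "row_apply Z n (L ! i) (last vs) = 0" using zero by blast
    then show ?thesis using False that last r
      by (auto simp: wedge_mat_def L nth_append c)
  qed
  have "wedge_minor Z n a vs = (\<Sum>i<?r. ?A $$ (i, ?i) * cofactor ?A i ?i)"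
    unfolding wedge_minor_def by (rule laplace_expansion_column) (use r in auto)
  also have "\<dots> = (\<Sum>i<?r. if i = ?i then row_apply Z n k (last vs) * cofactor ?A i ?i else 0)"
  proof (rule sum.cong[OF refl])
    fix i assume "i \<in> {..<?r}"
    then have "i < ?r" by simp
    then show "?A $$ (i, ?i) * cofactor ?A i ?i
        = (if i = ?i then row_apply Z n k (last vs) * cofactor ?A i ?i else 0)"
      unfolding z[OF \<open>i < ?r\<close>] by (simp only: if_distribR mult_zero_left split: if_split) simp
  qed
  also have "\<dots> = row_apply Z n k (last vs) * cofactor ?A ?i ?i" using r by simp
  \<comment> \<open>The exponent of the sign is twice a position, so the sign is 1.\<close>
  also have "cofactor ?A ?i ?i = det (mat_delete ?A ?i ?i)"
    by (simp only: cofactor_def minus_one_power_iff even_add simp_thms if_True mult_1)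
  also have "\<dots> = wedge_minor Z n (a - {k}) (take ?i vs @ drop (Suc ?i) vs)"
    using mat_delete_wedge_mat_last[OF a vs, of ?i] r by (simp add: wedge_minor_def)
  also have "take ?i vs @ drop (Suc ?i) vs = butlast vs" using vs r by (simp add: butlast_conv_take)
  finally show ?thesis .
qed

text \<open>The zero block has \<open>i + 1\<close> rows and \<open>card a - i\<close> columns, one
  more in total than the size of the matrix.\<close>

lemma wedge_minor_zero_block:
  assumes "i < card a"
    and "\<And>i' l. i' \<le> i \<Longrightarrow> i \<le> l \<Longrightarrow> l < card a \<Longrightarrow> row_apply Z n (sorted_list_of_set a ! i') (vs ! l) = 0"
  shows "wedge_minor Z n a vs = 0"
  unfolding wedge_minor_def
  by (rule det_zero_block[of _ "card a" "{0..i}" "{i..<card a}"]) (use assms in \<open>auto simp: wedge_mat_def\<close>)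

text \<open>The cofactors of a column do not involve that column, so they may be taken before the
  replacement.\<close>

lemma wedge_minor_update:
  assumes "length v = card a" "l < card a"
  shows "wedge_minor Z n a (v[l := u])
    = (\<Sum>t<card a. row_apply Z n (sorted_list_of_set a ! t) u * cofactor (wedge_mat Z n a v) t l)"
proof -
  have "wedge_minor Z n a (v[l := u])
      = (\<Sum>t<card a. wedge_mat Z n a (v[l := u]) $$ (t, l) * cofactor (wedge_mat Z n a (v[l := u])) t l)"
    unfolding wedge_minor_def by (rule laplace_expansion_column) (use assms in auto)
  moreover have "cofactor (wedge_mat Z n a (v[l := u])) t l = cofactor (wedge_mat Z n a v) t l" for t
    by (rule cofactor_cong) (use assms in \<open>auto simp: wedge_mat_def\<close>)
  ultimately show ?thesis using assms by (simp add: wedge_mat_def)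
qed

text \<open>Expanding the updated minor along its column \<open>l\<close>, the sum over \<open>p\<close> becomes a combination of
  the minors for \<open>a\<close> with the bottom row \<open>k\<close> replaced by the rows \<open>t\<close> of \<open>a'\<close>. These vanish for
  \<open>t < k\<close> since \<open>t \<in> a\<close>; for \<open>t > k\<close> the sum over \<open>l\<close> is a minor with row \<open>k\<close> repeated.\<close>

lemma wedge_minor_exchange:
  assumes a: "finite a" "a \<noteq> {}" "Max a = k" and w: "length w = card a" and v: "length v = card a'"
    and i: "i < card a'" "sorted_list_of_set a' ! i = k"
    and above: "\<And>i'. i' < i \<Longrightarrow> sorted_list_of_set a' ! i' \<in> a - {k}"
    and zero: "\<And>i' l. i' < i \<Longrightarrow> i \<le> l \<Longrightarrow> l < card a' \<Longrightarrow>
      row_apply Z n (sorted_list_of_set a' ! i') (v ! l) = 0"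
  shows "wedge_minor Z n a w * wedge_minor Z n a' v =
    (\<Sum>l\<in>{i..<card a'}. \<Sum>p<card a. row_apply Z n k (v ! l) * (-1) ^ (card a - 1 + p) *
       (wedge_minor Z n (a - {k}) (take p w @ drop (Suc p) w) * wedge_minor Z n a' (v[l := w ! p])))"
proof -
  let ?W = "wedge_mat Z n a w" and ?V = "wedge_mat Z n a' v" and ?s = "card a" and ?r = "card a'"
  let ?a' = "\<lambda>t. sorted_list_of_set a' ! t"
  define D where "D t = (\<Sum>p<?s. row_apply Z n t (w ! p) * cofactor ?W (?s - 1) p)" for t
  have s: "?s > 0" using a by (simp add: card_gt_0_iff)
  have k: "k \<in> a" using Max_in[OF a(1,2)] a(3) by simp
  have c: "card (a - {k}) = ?s - 1" using a k by simp
  obtain L where L: "sorted_list_of_set (a - {k}) = L" "sorted_list_of_set a = L @ [k]" "length L = card a - 1"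
    using sorted_list_of_set_snoc[OF a] c by (metis length_sorted_list_of_set)
  have DW: "D (sorted_list_of_set a ! m) = (if m = ?s - 1 then det ?W else 0)" if "m < ?s" for m
  proof -
    have "D (sorted_list_of_set a ! m) = (\<Sum>p<?s. ?W $$ (m, p) * cofactor ?W (?s - 1) p)"
      unfolding D_def by (rule sum.cong) (use that in \<open>auto simp: wedge_mat_def\<close>)
    then show ?thesis using sum_row_cofactor[of ?W ?s m "?s - 1"] that s by simp
  qed
  have Dk: "D k = det ?W"
    using DW[of "?s - 1"] s by (simp add: L nth_append c)
  have D0: "D t = 0" if "t \<in> a - {k}" for t
  proof -
    have "set L = a - {k}" using a(1) L(1) by (metis finite_Diff set_sorted_list_of_set)
    with that have "t \<in> set L" by (simp only:)
    then obtain m where "m < length L" and Lm: "L ! m = t" unfolding in_set_conv_nth by blast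
    with L(3) have m: "m < ?s - 1" by (simp only:)
    with Lm have "sorted_list_of_set a ! m = t" by (simp add: L nth_append c)
    with DW[of m] m show ?thesis by simp
  qed
  have V: "?V $$ (i, l) = row_apply Z n k (v ! l)" if "l < ?r" for l
    using i that by (simp add: wedge_mat_def)
  have summand: "(\<Sum>l\<in>{i..<?r}. row_apply Z n k (v ! l) * (cofactor ?V t l * D (?a' t)))
      = (if t = i then det ?V * det ?W else 0)" if t: "t < ?r" for t
  proof (cases "t < i")
    case True
    then show ?thesis using D0[OF above] by simp
  next
    case False
    \<comment> \<open>The sum may be extended to all \<open>l\<close>, since the cofactors of rows
      from \<open>i\<close> on vanish in the columns before \<open>i\<close>. It is then row
      \<open>i\<close> against the cofactors of row \<open>t\<close>.\<close>
    have "(\<Sum>l\<in>{i..<?r}. row_apply Z n k (v ! l) * (cofactor ?V t l * D (?a' t)))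
        = (\<Sum>l<?r. ?V $$ (i, l) * cofactor ?V t l * D (?a' t))"
    proof (rule sum.mono_neutral_cong_left)
      show "\<forall>l\<in>{..<?r} - {i..<?r}. ?V $$ (i, l) * cofactor ?V t l * D (?a' t) = 0"
      proof
        fix l assume "l \<in> {..<?r} - {i..<?r}"
        then have "cofactor ?V t l = 0"
          by (intro cofactor_zero_block[of _ ?r i]) (use zero False t i in \<open>auto simp: wedge_mat_def\<close>)
        then show "?V $$ (i, l) * cofactor ?V t l * D (?a' t) = 0" by simp
      qed
    qed (auto simp: V mult.assoc)
    also have "\<dots> = (if i = t then det ?V else 0) * D (?a' t)"
      using sum_row_cofactor[of ?V ?r i t] i t by (simp add: sum_distrib_right[symmetric])
    finally show ?thesis using i Dk by auto
  qed
  have "(\<Sum>p<?s. (-1) ^ (?s - 1 + p) *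
       (wedge_minor Z n (a - {k}) (take p w @ drop (Suc p) w) * wedge_minor Z n a' (v[l := w ! p])))
    = (\<Sum>t<?r. cofactor ?V t l * D (?a' t))" if l: "l < ?r" for l
  proof -
    have "(-1) ^ (?s - 1 + p) * (wedge_minor Z n (a - {k}) (take p w @ drop (Suc p) w) * wedge_minor Z n a' (v[l := w ! p]))
      = (\<Sum>t<?r. cofactor ?V t l * (row_apply Z n (?a' t) (w ! p) * cofactor ?W (?s - 1) p))" if p: "p < ?s" for p
    proof -
      have "cofactor ?W (?s - 1) p = (-1) ^ (?s - 1 + p) * wedge_minor Z n (a - {k}) (take p w @ drop (Suc p) w)"
        by (simp only: cofactor_def mat_delete_wedge_mat_last[OF a w p] wedge_minor_def)
      then show ?thesis
        by (simp add: wedge_minor_update[OF v l] sum_distrib_left mult_ac)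
    qed
    then have "(\<Sum>p<?s. (-1) ^ (?s - 1 + p) *
       (wedge_minor Z n (a - {k}) (take p w @ drop (Suc p) w) * wedge_minor Z n a' (v[l := w ! p])))
      = (\<Sum>p<?s. \<Sum>t<?r. cofactor ?V t l * (row_apply Z n (?a' t) (w ! p) * cofactor ?W (?s - 1) p))"
      by (intro sum.cong) auto
    also have "\<dots> = (\<Sum>t<?r. cofactor ?V t l * D (?a' t))"
      by (subst sum.swap) (simp add: D_def sum_distrib_left)
    finally show ?thesis .
  qed
  then have "(\<Sum>l\<in>{i..<?r}. \<Sum>p<?s. row_apply Z n k (v ! l) * (-1) ^ (?s - 1 + p) *
       (wedge_minor Z n (a - {k}) (take p w @ drop (Suc p) w) * wedge_minor Z n a' (v[l := w ! p])))
    = (\<Sum>l\<in>{i..<?r}. row_apply Z n k (v ! l) * (\<Sum>t<?r. cofactor ?V t l * D (?a' t)))"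
    by (intro sum.cong refl) (simp add: sum_distrib_left[symmetric] mult.assoc)
  also have "\<dots> = (\<Sum>t<?r. \<Sum>l\<in>{i..<?r}. row_apply Z n k (v ! l) * (cofactor ?V t l * D (?a' t)))"
    by (subst sum.swap) (simp add: sum_distrib_left)
  also have "\<dots> = (\<Sum>t<?r. if t = i then det ?V * det ?W else 0)"
    by (intro sum.cong refl) (simp add: summand)
  also have "\<dots> = wedge_minor Z n a w * wedge_minor Z n a' v"
    using i by (simp add: wedge_minor_def mult.commute)
  finally show ?thesis ..
qed

text \<open>Only the columns from \<open>i\<close> on matter, because the cofactors of row
  \<open>i\<close> vanish in the others. There the two rows are proportional. The factor \<xi> stays
  in the conclusion, to be cancelled once it is a variable.\<close>

lemma wedge_minor_proportional_rows:
  assumes i: "Suc i < card a"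
    and zero: "\<And>i' l. i' < i \<Longrightarrow> i \<le> l \<Longrightarrow> l < card a \<Longrightarrow>
      row_apply Z n (sorted_list_of_set a ! i') (v ! l) = 0"
    and proportional: "\<And>l. i \<le> l \<Longrightarrow> l < card a \<Longrightarrow>
      \<xi> * row_apply Z n (sorted_list_of_set a ! i) (v ! l)
        = \<zeta> * row_apply Z n (sorted_list_of_set a ! Suc i) (v ! l)"
  shows "\<xi> * wedge_minor Z n a v = 0"
proof -
  let ?V = "wedge_mat Z n a v" and ?r = "card a"
  \<comment> \<open>The subtracted sum is zero: it pairs row \<open>i + 1\<close> with the cofactors
    of row \<open>i\<close>.\<close>
  have "\<xi> * det ?V = (\<Sum>l<?r. \<xi> * (?V $$ (i, l) * cofactor ?V i l)) - (\<Sum>l<?r. \<zeta> * (?V $$ (Suc i, l) * cofactor ?V i l))"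
    using sum_row_cofactor[of ?V ?r i i] sum_row_cofactor[of ?V ?r "Suc i" i] i
    by (simp add: sum_distrib_left[symmetric])
  also have "\<dots> = (\<Sum>l<?r. (\<xi> * ?V $$ (i, l) - \<zeta> * ?V $$ (Suc i, l)) * cofactor ?V i l)"
    by (simp add: sum_subtractf[symmetric] algebra_simps)
  also have "\<dots> = 0"
  proof (rule sum.neutral, rule ballI)
    fix l assume l: "l \<in> {..<?r}"
    show "(\<xi> * ?V $$ (i, l) - \<zeta> * ?V $$ (Suc i, l)) * cofactor ?V i l = 0"
    proof (cases "l < i")
      case True
      then have "cofactor ?V i l = 0"
        by (intro cofactor_zero_block[of _ ?r i]) (use zero i in \<open>auto simp: wedge_mat_def\<close>)
      then show ?thesis by simp
    next
      case False
      then show ?thesis using proportional[of l] l i by (simp add: wedge_mat_def)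
    qed
  qed
  finally show ?thesis by (simp add: wedge_minor_def)
qed

section \<open>Swapping adjacent rows\<close>

text \<open>The sign is -1 if both rows occur in \<open>a\<close> and 1 otherwise. It is chosen
  before \<open>Z\<close> and \<open>b\<close>, so that it can be factored out of a sum over
  tableaux.\<close>

lemma minor_swap_rows:
  assumes "finite a"
  shows "\<exists>\<epsilon>\<in>{1, -1}. \<forall>(Z :: nat \<Rightarrow> nat \<Rightarrow> 'a::comm_ring_1) b.
    minor Z (Transposition.transpose k (k + 1) ` a) b = \<epsilon> * minor (\<lambda>p. Z (Transposition.transpose k (k + 1) p)) a b"
proof -
  let ?s = "Transposition.transpose k (k + 1)"
  let ?l = "sorted_list_of_set a" and ?r = "card a"
  have card: "card (?s ` a) = ?r" by (intro card_image inj_on_subset[OF inj_swap]) simp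
  show ?thesis
  proof (cases "k \<in> a \<and> k + 1 \<in> a")
    case True
    then have sa: "?s ` a = a" by (auto simp: Transposition.transpose_def image_iff) 
    obtain i where i: "i < ?r" "?l ! i = k"
      using True assms(1) by (metis in_set_conv_nth length_sorted_list_of_set set_sorted_list_of_set)
    obtain j where j: "j < ?r" "?l ! j = k + 1"
      using True assms(1) by (metis in_set_conv_nth length_sorted_list_of_set set_sorted_list_of_set)
    have ij: "i \<noteq> j" using i j by auto
    have eq: "?l ! m = ?l ! m' \<longleftrightarrow> m = m'" if "m < ?r" "m' < ?r" for m m'
      using that by (simp add: nth_eq_iff_index_eq)
    have val: "?s (?l ! m) = (if m = i then k + 1 else if m = j then k else ?l ! m)" if "m < ?r" for m
      using eq[OF that i(1)] eq[OF that j(1)] unfolding i(2) j(2) Transposition.transpose_def by auto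
    have "minor (\<lambda>p. Z (?s p)) a b = - minor Z a b" for Z :: "nat \<Rightarrow> nat \<Rightarrow> 'a" and b
    proof -
      let ?M = "mat ?r ?r (\<lambda>(i, j). Z (?l ! i) (sorted_list_of_set b ! j))"
      have "mat ?r ?r (\<lambda>(i, j). Z (?s (?l ! i)) (sorted_list_of_set b ! j)) = swaprows i j ?M"
        by (rule eq_matI) (use i j ij val in auto)
      then show ?thesis unfolding minor_def
        using det_swaprows[OF i(1) j(1) ij, of ?M] by simp
    qed
    then show ?thesis using sa by (intro bexI[of _ "-1"]) auto
  next
    case False
    \<comment> \<open>With at most one of the two rows present the swap preserves the order on
      \<open>a\<close>.\<close>
    then have "strict_mono_on a ?s"
      by (auto simp: strict_mono_on_def Transposition.transpose_def)
    then have "sorted_list_of_set (?s ` a) = map ?s ?l"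
      by (intro sorted_distinct_set_unique)
         (use assms in \<open>auto simp: sorted_wrt_map distinct_map inj_on_def strict_mono_on_eq strict_mono_on_leD
            intro!: sorted_wrt_mono_rel[OF _ sorted_sorted_list_of_set]\<close>)
    then have "minor Z (?s ` a) b = minor (\<lambda>p. Z (?s p)) a b" for Z :: "nat \<Rightarrow> nat \<Rightarrow> 'a" and b
      unfolding minor_def card by (intro arg_cong[of _ _ det] eq_matI) auto
    then show ?thesis by (intro bexI[of _ 1]) auto
  qed
qed

section \<open>The flag with the repeated step\<close>

lemma std_flag_eq: "std_flag n c = {v :: 'k::comm_ring_1 vec_E. \<forall>i. i \<notin> {c + 1..n} \<longrightarrow> v i = 0}" (is "_ = ?S")
proof
  have sub: "fscale.subspace ?S" by (auto simp: fscale.subspace_def fscale_def)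
  show "std_flag n c \<subseteq> ?S"
    unfolding std_flag_def by (rule fscale.span_minimal[OF _ sub]) (auto simp: basis_vec_def)
  show "?S \<subseteq> std_flag n c"
  proof
    fix v :: "'k vec_E" assume v: "v \<in> ?S"
    have "v = (\<Sum>q\<in>{c + 1..n}. fscale (v q) (basis_vec q))"
    proof
      fix i
      have "(\<Sum>q\<in>{c + 1..n}. v q * basis_vec q i) = (\<Sum>q\<in>{c + 1..n}. if q = i then v q else 0)"
        by (rule sum.cong) (auto simp: basis_vec_def)
      then show "v i = (\<Sum>q\<in>{c + 1..n}. fscale (v q) (basis_vec q)) i"
        using v by (auto simp: sum_fun_apply fscale_def)
    qed
    also have "\<dots> \<in> std_flag n c"
      unfolding std_flag_def
      by (intro fscale.span_sum fscale.span_scale fscale.span_base) auto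
    finally show "v \<in> std_flag n c" .
  qed
qed

lemma subspace_std_flag: "fscale.subspace (std_flag n c)"
  unfolding std_flag_def by (rule fscale.subspace_span)

lemma std_flag_antimono: "c \<le> c' \<Longrightarrow> std_flag n c' \<subseteq> std_flag n c"
  by (auto simp: std_flag_eq)

lemma std_flag_subset: "std_flag n c \<subseteq> space_E n"
  by (auto simp: std_flag_eq space_E_def)

lemma basis_vec_mem_std_flag: "basis_vec q \<in> (std_flag n c :: 'k::comm_ring_1 vec_E set) \<longleftrightarrow> q \<in> {c + 1..n}"
  by (auto simp: std_flag_eq basis_vec_def)

text \<open>The flag \<open>R\<^bsub>k+1\<^esub>E\<close>; its term in position \<open>p\<close> has rank \<open>width k p\<close>.\<close>

definition stretched_flag :: "nat \<Rightarrow> nat \<Rightarrow> 'k::comm_ring_1 flag" where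
  "stretched_flag n k = bs_op (k + 1) (std_flag n)"

definition stretched_matrix :: "nat \<Rightarrow> nat \<Rightarrow> nat \<Rightarrow> nat \<Rightarrow> 'k::comm_ring_1 zpoly" where
  "stretched_matrix n k = flagged_matrix (stretched_flag n k)"

definition width :: "nat \<Rightarrow> nat \<Rightarrow> nat" where
  "width k p = (if p \<le> k then p else p - 1)"

lemma width_mono: "p \<le> p' \<Longrightarrow> width k p \<le> width k p'"
  by (auto simp: width_def)

lemma stretched_flag_eq: "stretched_flag n k p = std_flag n (width k p)"
  by (auto simp: stretched_flag_def bs_op_def width_def)

text \<open>The two flags differ in position \<open>k\<close> only, so new flag relations can come
  only from boxes in row \<open>k\<close>.\<close>

lemma bs_op_eq_stretched: "p \<noteq> k \<Longrightarrow> bs_op k (std_flag n) p = stretched_flag n k p"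
  by (auto simp: stretched_flag_def bs_op_def)

lemma bs_op_at: "bs_op k (std_flag n) k = std_flag n (k - 1)"
  by (simp add: bs_op_def)

lemma stretched_matrix_eq:
  "stretched_matrix n k p q = (if q \<in> {width k p + 1..n} then 0 else generic_matrix p q)"
  by (simp add: stretched_matrix_def flagged_matrix_def stretched_flag_eq basis_vec_mem_std_flag)

section \<open>Flag relations and exchange relations under products of minors\<close>

lemma row_apply_zero:
  assumes "v \<in> std_flag n c" "width k p \<le> c"
  shows "row_apply (stretched_matrix n k) n p v = 0"
  unfolding row_apply_def
proof (rule sum.neutral, rule ballI)
  fix q assume "q \<in> {1..n}"
  then show "zconst (v q) * stretched_matrix n k p q = 0"
    using assms by (cases "q \<le> c") (auto simp: std_flag_eq stretched_matrix_eq)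
qed

text \<open>The vector has coordinates from \<open>k\<close> on and the row has entries up to
  \<open>k\<close>, so they meet only in \<open>k\<close>. This applies to the rows \<open>k\<close>
  and \<open>k + 1\<close> alike.\<close>

lemma row_apply_top:
  assumes v: "v \<in> std_flag n (k - 1)" and k: "1 \<le> k" "k \<le> n" and w: "width k p = k"
  shows "row_apply (stretched_matrix n k) n p v = zconst (v k) * generic_matrix p k"
proof -
  have "zconst (v q) * stretched_matrix n k p q = (if q = k then zconst (v k) * generic_matrix p k else 0)"
    if "q \<in> {1..n}" for q
    using that v k w by (cases q k rule: linorder_cases) (auto simp: std_flag_eq stretched_matrix_eq)
  then have "row_apply (stretched_matrix n k) n p v = (\<Sum>q\<in>{1..n}. if q = k then zconst (v k) * generic_matrix p k else 0)"
    unfolding row_apply_def by (rule sum.cong[OF refl])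
  then show ?thesis using k by simp
qed

text \<open>Widths grow with the row, so a vector killed in the row of the box at position
  \<open>i\<close> is killed in all earlier rows of that column; this is a zero block too large for
  a nonzero minor.\<close>

lemma minors_map_flag_generator:
  assumes len: "\<And>j. j < length D \<Longrightarrow> length (vss ! j) = card (D ! j)"
    and j: "j < length D" "i < card (D ! j)"
    and v: "\<And>l. i \<le> l \<Longrightarrow> l < card (D ! j) \<Longrightarrow> vss ! j ! l \<in> stretched_flag n k (sorted_list_of_set (D ! j) ! i)"
  shows "minors_map (stretched_matrix n k) n D (tensor_of_wedges n D vss) = 0"
proof -
  have "wedge_minor (stretched_matrix n k) n (D ! j) (vss ! j) = 0"
  proof (rule wedge_minor_zero_block[OF j(2)])
    fix i' l assume i: "i' \<le> i" "i \<le> l" "l < card (D ! j)"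
    have "sorted_list_of_set (D ! j) ! i' \<le> sorted_list_of_set (D ! j) ! i"
      by (rule sorted_nth_mono) (use i j in auto)
    then show "row_apply (stretched_matrix n k) n (sorted_list_of_set (D ! j) ! i') (vss ! j ! l) = 0"
      by (rule row_apply_zero[OF v[OF i(2,3), unfolded stretched_flag_eq] width_mono])
  qed
  moreover have "minors_map (stretched_matrix n k) n D (tensor_of_wedges n D vss)
      = (\<Prod>j<length D. wedge_minor (stretched_matrix n k) n (D ! j) (vss ! j))"
    by (rule minors_map_tensor_of_wedges) (rule len)
  ultimately show ?thesis using j by (auto intro!: prod_zero)
qed

lemma flag_rels_subset: "flag_rels n F D \<subseteq> TE n D"
  unfolding flag_rels_def by (rule fscale.span_minimal[OF _ subspace_TE]) (auto intro: tensor_of_wedges_mem)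

text \<open>The flagged matrix is a specialisation of the generic one, so a relation among generic
  minors persists.\<close>

lemma minors_map_exchange_rels:
  assumes "x \<in> exchange_rels n D"
  shows "minors_map (flagged_matrix F) n D x = 0"
proof -
  let ?\<sigma> = "\<lambda>(p, q). flagged_matrix F p q"
  have "minors_map (flagged_matrix F) n D x = subst ?\<sigma> (minors_map generic_matrix n D x)"
    by (subst minors_map_hom[OF comm_ring_hom_subst subst_zconst]) (simp add: subst_generic)
  then show ?thesis using assms by (simp add: exchange_rels_def subst_zero)
qed

lemma subspace_kernel: "fscale.subspace {x \<in> TE n D. minors_map Z n D x = 0}"
  using subspace_TE[of n D] unfolding fscale.subspace_def
  by (auto simp: minors_map_add minors_map_zero minors_map_scale simp del: zero_fun_def plus_fun_def)

lemma subspace_exchange_rels: "fscale.subspace (exchange_rels n D)"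
  unfolding exchange_rels_def by (rule subspace_kernel)

lemma schur_rels_subset_kernel:
  "schur_rels n (stretched_flag n k) D \<subseteq> {x \<in> TE n D. minors_map (stretched_matrix n k) n D x = 0}"
proof -
  let ?K = "{x \<in> TE n D. minors_map (stretched_matrix n k) n D x = 0}"
  have "flag_rels n (stretched_flag n k) D \<subseteq> ?K"
    unfolding flag_rels_def
  proof (rule fscale.span_minimal[OF _ subspace_kernel], clarify)
    fix vss j i
    assume "\<forall>j<length D. length (vss ! j) = card (D ! j) \<and> set (vss ! j) \<subseteq> space_E n"
      "j < length D" "i < card (D ! j)"
      "\<forall>l. i \<le> l \<and> l < card (D ! j) \<longrightarrow> vss ! j ! l \<in> stretched_flag n k (sorted_list_of_set (D ! j) ! i)"
    then show "tensor_of_wedges n D vss \<in> TE n D \<and>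
        minors_map (stretched_matrix n k) n D (tensor_of_wedges n D vss) = 0"
      by (intro conjI tensor_of_wedges_mem minors_map_flag_generator[of D vss j i]) auto
  qed
  moreover have "exchange_rels n D \<subseteq> ?K"
    using minors_map_exchange_rels unfolding stretched_matrix_def by (auto simp: exchange_rels_def)
  ultimately show ?thesis
    unfolding schur_rels_def set_plus_def
    using fscale.subspace_add[OF subspace_kernel] by blast
qed

text \<open>One inclusion says that products of minors are well defined on the Schur module, the
  other is the embedding hypothesis.\<close>

lemma schur_rels_eq_kernel:
  assumes "embeds_in_polys n (stretched_flag n k :: 'k::comm_ring_1 flag) D"
  shows "schur_rels n (stretched_flag n k :: 'k flag) D = {x \<in> TE n D. minors_map (stretched_matrix n k) n D x = 0}"
proof
  show "{x \<in> TE n D. minors_map (stretched_matrix n k) n D x = 0} \<subseteq> schur_rels n (stretched_flag n k :: 'k flag) D"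
    using assms unfolding embeds_in_polys_def stretched_matrix_def by blast
qed (rule schur_rels_subset_kernel)

lemma subspace_set_plus:
  assumes "fscale.subspace A" "fscale.subspace B"
  shows "fscale.subspace (A + B)"
proof (rule fscale.subspaceI)
  show "0 \<in> A + B"
    using set_plus_intro[OF fscale.subspace_0[OF assms(1)] fscale.subspace_0[OF assms(2)]] by (simp only: add_0_left)
next
  fix x y assume "x \<in> A + B" "y \<in> A + B"
  then obtain u v u' v' where "x = u + v" "y = u' + v'" "u \<in> A" "v \<in> B" "u' \<in> A" "v' \<in> B"
    by (elim set_plus_elim)
  moreover from this have "(u + u') + (v + v') \<in> A + B"
    by (intro set_plus_intro fscale.subspace_add[OF assms(1)] fscale.subspace_add[OF assms(2)])
  ultimately show "x + y \<in> A + B" by (simp only: add_ac)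
next
  fix c x assume "x \<in> A + B"
  then obtain u v where "x = u + v" "u \<in> A" "v \<in> B" by (elim set_plus_elim)
  moreover from this have "fscale c u + fscale c v \<in> A + B"
    by (intro set_plus_intro fscale.subspace_scale[OF assms(1)] fscale.subspace_scale[OF assms(2)])
  ultimately show "fscale c x \<in> A + B" by (simp only: fscale.scale_right_distrib)
qed

lemma subspace_schur_rels: "fscale.subspace (schur_rels n F D)"
proof -
  have "fscale.subspace (flag_rels n F D)" unfolding flag_rels_def by (rule fscale.subspace_span)
  then show ?thesis using subspace_set_plus[OF _ subspace_exchange_rels] by (simp only: schur_rels_def)
qed

lemma schur_rels_subset: "schur_rels n F D \<subseteq> TE n D"
  unfolding schur_rels_def set_plus_def
  using flag_rels_subset fscale.subspace_add[OF subspace_TE] by (fastforce simp: exchange_rels_def)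

lemma schur_rels_mono:
  assumes "\<And>p. F p \<subseteq> F' p"
  shows "schur_rels n F D \<subseteq> schur_rels n F' D"
proof -
  have "flag_rels n F D \<subseteq> flag_rels n F' D"
    unfolding flag_rels_def
    by (rule fscale.span_mono) (use assms in blast)
  then show ?thesis unfolding schur_rels_def by (rule set_plus_mono2) simp
qed

section \<open>The action of lower triangular matrices on polynomials\<close>

text \<open>The substitution that replaces the generic matrix by the product of the stretched matrix
  with \<open>g\<close>.\<close>

definition col_action :: "nat \<Rightarrow> nat \<Rightarrow> (nat \<Rightarrow> nat \<Rightarrow> 'k) \<Rightarrow> 'k zpoly \<Rightarrow> 'k::comm_ring_1 zpoly" where
  "col_action n k g = subst (\<lambda>(p, q). \<Sum>i\<in>{1..n}. zconst (g i q) * stretched_matrix n k p i)"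

lemma apply_E_basis_vec: "q \<in> {1..n} \<Longrightarrow> apply_E n g (basis_vec q) = (\<lambda>i. g i q)"
proof
  fix i assume "q \<in> {1..n}"
  moreover have "(\<Sum>j\<in>{1..n}. g i j * basis_vec q j) = (\<Sum>j\<in>{1..n}. if j = q then g i q else 0)"
    by (rule sum.cong) (auto simp: basis_vec_def)
  ultimately show "apply_E n g (basis_vec q) i = g i q" by (simp add: apply_E_def)
qed

text \<open>At an entry that is already 0 the formula still holds: column \<open>q\<close> of
  \<open>g\<close> only involves \<open>i \<ge> q\<close>, and the entries of row \<open>p\<close>
  in those columns are 0 as well.\<close>

lemma col_action_matrix:
  assumes g: "g \<in> lower_triangular n" and q: "q \<in> {1..n}"
  shows "col_action n k g (stretched_matrix n k p q) = (\<Sum>i\<in>{1..n}. zconst (g i q) * stretched_matrix n k p i)"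
proof (cases "q \<in> {width k p + 1..n}")
  case True
  have "zconst (g i q) * stretched_matrix n k p i = 0" if "i \<in> {1..n}" for i
    using True that g by (cases "i < q") (auto simp: lower_triangular_def stretched_matrix_eq)
  then have "(\<Sum>i\<in>{1..n}. zconst (g i q) * stretched_matrix n k p i) = 0" by (intro sum.neutral) blast
  then show ?thesis using True by (simp add: col_action_def stretched_matrix_eq subst_zero)
next
  case False
  then have "stretched_matrix n k p q = (generic_matrix p q :: 'a zpoly)" by (simp only: stretched_matrix_eq if_False)
  then show ?thesis by (simp only: col_action_def subst_generic prod.case)
qed

text \<open>The functorial action becomes a ring endomorphism. Its multiplicativity is what lets the
  factor \<open>z_kk\<close> be treated separately.\<close>

lemma minors_map_act:
  assumes g: "g \<in> lower_triangular n"
  shows "minors_map (stretched_matrix n k) n D (act_TE n D g x)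
    = col_action n k g (minors_map (stretched_matrix n k) n D x)"
proof -
  have hom: "comm_ring_hom (col_action n k g)" "\<And>c. col_action n k g (zconst c) = zconst c"
    unfolding col_action_def by (rule comm_ring_hom_subst) (rule subst_zconst)
  have "minors_map (stretched_matrix n k) n D (act_TE n D g x)
      = minors_map (\<lambda>p q. col_action n k g (stretched_matrix n k p q)) n D x"
    unfolding minors_map_act_TE
    by (rule fun_cong[OF minors_map_cong]) (simp only: col_action_matrix[OF g] apply_E_basis_vec row_apply_def)
  also have "\<dots> = col_action n k g (minors_map (stretched_matrix n k) n D x)"
    by (rule minors_map_hom[OF hom, symmetric])
  finally show ?thesis .
qed

lemma col_action_add: "col_action n k g (p + q) = col_action n k g p + col_action n k g q"
  by (simp add: col_action_def subst_add)

lemma col_action_mult: "col_action n k g (p * q) = col_action n k g p * col_action n k g q"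
  by (simp add: col_action_def subst_mult)

lemma col_action_scale: "col_action n k g (zconst c * p) = zconst c * col_action n k g p"
  by (simp add: col_action_def subst_mult subst_zconst)

text \<open>Column \<open>k\<close> of \<open>g\<close> lives in rows from \<open>k\<close> on and
  row \<open>k\<close> of the matrix in columns up to \<open>k\<close>, so only the diagonal entry
  of \<open>g\<close> is left: \<open>z_kk\<close> is an eigenvector.\<close>

lemma col_action_corner:
  assumes g: "g \<in> lower_triangular n" and k: "1 \<le> k" "k \<le> n"
  shows "col_action n k g (generic_matrix k k) = zconst (g k k) * generic_matrix k k"
proof -
  have "zconst (g i k) * stretched_matrix n k k i = (if i = k then zconst (g k k) * generic_matrix k k else 0)"
    if "i \<in> {1..n}" for i
    using that g by (cases i k rule: linorder_cases) (auto simp: lower_triangular_def stretched_matrix_eq width_def)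
  then have "(\<Sum>i\<in>{1..n}. zconst (g i k) * stretched_matrix n k k i)
      = (\<Sum>i\<in>{1..n}. if i = k then zconst (g k k) * generic_matrix k k else 0)"
    by (rule sum.cong[OF refl])
  then show ?thesis
    using col_action_matrix[OF g, of k k k] k by (simp add: stretched_matrix_eq width_def)
qed

section \<open>Removing the box of the descent\<close>

text \<open>The descent condition without reordering: a column with the box \<open>k\<close> is
  either \<open>k\<close>-full or has its boxes up to row \<open>k + 1\<close> inside
  \<open>a\<close>. \<open>J\<close> is a position of the witnessing column.\<close>

locale descent =
  fixes n k :: nat and D :: diagram and a :: "nat set" and J :: nat
  assumes k: "1 \<le> k" and rows: "in_rows n D" and J: "J < length D" "D ! J = a"
    and a: "a \<noteq> {}" "Max a = k"
    and other: "\<And>j. j < length D \<Longrightarrow> k \<in> D ! j \<Longrightarrow> k + 1 \<notin> D ! j \<Longrightarrow> D ! j \<inter> {1..k + 1} \<subseteq> a"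
begin

definition punctured :: diagram where "punctured = D[J := a - {k}]"

lemma column_subset: "j < length D \<Longrightarrow> D ! j \<subseteq> {1..n}"
  using rows by (auto simp: in_rows_def)

lemma finite_column: "j < length D \<Longrightarrow> finite (D ! j)"
  using column_subset finite_subset by blast

lemma finite_a: "finite a" using finite_column J by blast

lemma k_mem: "k \<in> a" using Max_in[OF finite_a a(1)] a(2) by simp

lemma le_k: "p \<in> a \<Longrightarrow> p \<le> k" using Max_ge[OF finite_a] a(2) by simp

lemma k_le_n: "k \<le> n" using k_mem column_subset[OF J(1)] J(2) by auto

lemma length_punctured: "length punctured = length D" by (simp add: punctured_def)

lemma punctured_nth: "j < length D \<Longrightarrow> punctured ! j = (if j = J then a - {k} else D ! j)"
  by (simp add: punctured_def)

lemma finite_column_punctured: "j < length D \<Longrightarrow> finite (punctured ! j)"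
  using finite_column finite_a by (simp add: punctured_nth)

lemma card_a: "card (a - {k}) = card a - 1" "card a > 0"
  using k_mem finite_a by (auto simp: card_gt_0_iff)

abbreviation Z :: "nat \<Rightarrow> nat \<Rightarrow> 'k::comm_ring_1 zpoly" where "Z \<equiv> stretched_matrix n k"

abbreviation \<zeta> :: "'k::comm_ring_1 zpoly" where "\<zeta> \<equiv> generic_matrix k k"

lemma row_k: "v \<in> std_flag n (k - 1) \<Longrightarrow> row_apply Z n k v = \<zeta> * zconst (v k)"
  using row_apply_top[OF _ k k_le_n, of v k] by (simp add: width_def mult.commute)

lemma row_Suc_k: "v \<in> std_flag n (k - 1) \<Longrightarrow> row_apply Z n (k + 1) v = generic_matrix (k + 1) k * zconst (v k)"
  using row_apply_top[OF _ k k_le_n, of v "k + 1"] by (simp add: width_def mult.commute)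

lemma row_above: "v \<in> std_flag n (k - 1) \<Longrightarrow> p < k \<Longrightarrow> row_apply Z n p v = 0"
  by (rule row_apply_zero) (auto simp: width_def)

section \<open>The image of the kernel as multiples of \<open>z_kk\<close>\<close>

definition corner_image :: "'k::comm_ring_1 zpoly set" where
  "corner_image = (\<lambda>y. \<zeta> * minors_map Z n punctured y) ` TE n punctured"

lemma corner_image_closed:
  "0 \<in> corner_image"
  "p \<in> corner_image \<Longrightarrow> q \<in> corner_image \<Longrightarrow> p + q \<in> corner_image"
  "p \<in> corner_image \<Longrightarrow> zconst c * p \<in> corner_image"
proof -
  show "0 \<in> corner_image"
    unfolding corner_image_def
    by (rule image_eqI[of _ _ 0]) (simp_all only: minors_map_zero mult_zero_right fscale.subspace_0[OF subspace_TE])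
  show "p + q \<in> corner_image" if pq: "p \<in> corner_image" "q \<in> corner_image"
  proof -
    obtain x y where "x \<in> TE n punctured" "y \<in> TE n punctured"
      "p = \<zeta> * minors_map Z n punctured x" "q = \<zeta> * minors_map Z n punctured y"
      using pq by (auto simp: corner_image_def)
    then show ?thesis
      unfolding corner_image_def
      by (intro image_eqI[of _ _ "x + y"] fscale.subspace_add[OF subspace_TE])
         (simp_all only: minors_map_add distrib_left)
  qed
  show "zconst c * p \<in> corner_image" if p: "p \<in> corner_image"
  proof -
    obtain x where "x \<in> TE n punctured" "p = \<zeta> * minors_map Z n punctured x"
      using p by (auto simp: corner_image_def)
    then show ?thesis
      unfolding corner_image_def
      by (intro image_eqI[of _ _ "fscale c x"] fscale.subspace_scale[OF subspace_TE])
         (simp_all only: minors_map_scale mult.left_commute)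
  qed
qed

lemma corner_image_sum: "(\<And>i. i \<in> A \<Longrightarrow> f i \<in> corner_image) \<Longrightarrow> sum f A \<in> corner_image"
  by (induction A rule: infinite_finite_induct) (auto simp: corner_image_closed)

lemma corner_imageI:
  assumes "\<And>j. j < length D \<Longrightarrow> length (vss ! j) = card (punctured ! j)"
  shows "\<zeta> * (\<Prod>j<length D. wedge_minor Z n (punctured ! j) (vss ! j)) \<in> corner_image"
  unfolding corner_image_def
  by (rule image_eqI[of _ _ "tensor_of_wedges n punctured vss"])
     (use assms minors_map_tensor_of_wedges[of punctured vss Z n] in \<open>simp_all add: length_punctured tensor_of_wedges_mem\<close>)

text \<open>Unless the box at position \<open>i\<close> is \<open>k\<close>, this is already a
  relation for the stretched flag and its value is 0. Otherwise the vectors from \<open>i\<close> on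
  lie in \<open>\<langle>z_k, \<dots>, z_n\<rangle>\<close>: the rows above \<open>k\<close> kill
  them and the rows \<open>k\<close>, \<open>k + 1\<close> see only their coordinate
  \<open>k\<close>. The rest depends on the kind of column.\<close>

lemma flag_generator_mem:
  fixes vss :: "'k::comm_ring_1 vec_E list list"
  assumes len: "\<And>j. j < length D \<Longrightarrow> length (vss ! j) = card (D ! j)" "length vss = length D"
    and j: "j < length D" "i < card (D ! j)"
    and v: "\<And>l. i \<le> l \<Longrightarrow> l < card (D ! j) \<Longrightarrow>
      vss ! j ! l \<in> bs_op k (std_flag n) (sorted_list_of_set (D ! j) ! i)"
  shows "minors_map Z n D (tensor_of_wedges n D vss) \<in> corner_image"
proof (cases "sorted_list_of_set (D ! j) ! i = k")
  case False
  have "minors_map Z n D (tensor_of_wedges n D vss) = 0"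
    by (rule minors_map_flag_generator[OF len(1) j v[unfolded bs_op_eq_stretched[OF False]]])
  then show ?thesis by (simp only: corner_image_closed)
next
  case i: True
  let ?b = "D ! j" and ?v = "vss ! j"
  let ?l = "sorted_list_of_set ?b"
  define W where "W c = wedge_minor Z n (D ! c) (vss ! c)" for c
  have m: "minors_map Z n D (tensor_of_wedges n D vss) = (\<Prod>c<length D. W c)"
    unfolding W_def by (rule minors_map_tensor_of_wedges[OF len(1)])
  have v': "?v ! l \<in> std_flag n (k - 1)" if "i \<le> l" "l < card ?b" for l
    using v[OF that] by (simp only: i bs_op_at)
  have finb: "finite ?b" by (rule finite_column[OF j(1)])
  have strict: "?l ! i' < ?l ! i''" if "i' < i''" "i'' < card ?b" for i' i''
    using sorted_wrt_nth_less[OF strict_sorted_list_of_set] that by simp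
  have mem: "?l ! i' \<in> ?b" if "i' < card ?b" for i'
    using that finb by (metis length_sorted_list_of_set nth_mem set_sorted_list_of_set)
  have above: "?l ! i' < k" if "i' < i" for i'
    using strict[OF that j(2)] i by simp
  have zero: "row_apply Z n (?l ! i') (?v ! l) = 0" if "i' < i" "i \<le> l" "l < card ?b" for i' l
    by (rule row_above[OF v'[OF that(2,3)] above[OF that(1)]])
  have kb: "k \<in> ?b" using mem[OF j(2)] i by simp
  consider (full) "k + 1 \<in> ?b" | (witness) "j = J" "k + 1 \<notin> ?b" | (other) "j \<noteq> J" "k + 1 \<notin> ?b" by blast
  then show ?thesis
  proof cases
    case full
    then obtain i' where i': "i' < card ?b" "?l ! i' = k + 1"
      using finb by (metis in_set_conv_nth length_sorted_list_of_set set_sorted_list_of_set)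
    have "i' = Suc i"
    proof (rule ccontr)
      assume "i' \<noteq> Suc i"
      then consider "i' \<le> i" | "Suc i < i'" by linarith
      then show False
      proof cases
        case 1
        then show False using above[of i'] i i' by (cases "i' = i") auto
      next
        case 2
        then show False using strict[of i "Suc i"] strict[of "Suc i" i'] i i' by simp
      qed
    qed
    \<comment> \<open>On the relevant vectors row \<open>k\<close> is \<open>z_kk\<close> and row
      \<open>k + 1\<close> is \<open>z_{k+1,k}\<close> times the same coordinate, so the rows are
      proportional.\<close>
    then have "generic_matrix (k + 1) k * W j = 0"
      unfolding W_def using i' i zero
      by (intro wedge_minor_proportional_rows[where i = i and \<zeta> = \<zeta>])
         (simp_all add: row_k[OF v'] row_Suc_k[OF v', unfolded Suc_eq_plus1[symmetric]] mult_ac)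
    then have "W j = 0" by (rule generic_mult_cancel)
    then have "(\<Prod>c<length D. W c) = 0" using j by (intro prod_zero) auto
    then show ?thesis unfolding m by (simp only: corner_image_closed)
  next
    case witness
    have b: "?b = a" using witness J by simp
    \<comment> \<open>\<open>k\<close> is the largest box of \<open>a\<close>, hence its last one,
      and the condition concerns the last vector only.\<close>
    have "i = card a - 1"
    proof (rule ccontr)
      assume "i \<noteq> card a - 1"
      then have "i < card a - 1" using j(2) b by simp
      then have "k < ?l ! (card a - 1)" using strict[of i "card a - 1"] i b card_a by simp
      moreover have "?l ! (card a - 1) \<in> a" using mem[of "card a - 1"] b card_a by simp
      ultimately show False using le_k by fastforce
    qed
    moreover have "?v \<noteq> []" using len(1)[OF j(1)] b card_a by auto
    ultimately have "last ?v = ?v ! i" using len(1)[OF j(1)] b by (simp add: last_conv_nth)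
    then have lastv: "last ?v \<in> std_flag n (k - 1)" using v'[OF order_refl j(2)] by simp
    let ?u = "vss[J := butlast ?v]"
    have "wedge_minor Z n a ?v = row_apply Z n k (last ?v) * wedge_minor Z n (a - {k}) (butlast ?v)"
    proof (rule wedge_minor_last_column[OF finite_a a])
      show "length ?v = card a" using len(1)[OF j(1)] b by simp
      fix p assume "p \<in> a" "p \<noteq> k"
      then show "row_apply Z n p (last ?v) = 0" using row_above[OF lastv, of p] le_k[of p] by simp
    qed
    then have "W J = row_apply Z n k (last ?v) * wedge_minor Z n (a - {k}) (butlast ?v)"
      using witness(1) b by (simp add: W_def)
    then have WJ: "W J = zconst (last ?v k) * (\<zeta> * wedge_minor Z n (punctured ! J) (?u ! J))"
      unfolding row_k[OF lastv] using J len(2) by (simp add: punctured_nth mult_ac)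
    have "(\<Prod>c<length D. W c) = W J * (\<Prod>c\<in>{..<length D} - {J}. W c)"
      by (rule prod.remove) (use J in auto)
    also have "(\<Prod>c\<in>{..<length D} - {J}. W c)
        = (\<Prod>c\<in>{..<length D} - {J}. wedge_minor Z n (punctured ! c) (?u ! c))"
      by (rule prod.cong) (auto simp: W_def punctured_nth)
    also have "W J * \<dots> = zconst (last ?v k) * (\<zeta> * (wedge_minor Z n (punctured ! J) (?u ! J)
        * (\<Prod>c\<in>{..<length D} - {J}. wedge_minor Z n (punctured ! c) (?u ! c))))"
      unfolding WJ by (simp only: mult.assoc)
    also have "wedge_minor Z n (punctured ! J) (?u ! J) * (\<Prod>c\<in>{..<length D} - {J}. wedge_minor Z n (punctured ! c) (?u ! c))
        = (\<Prod>c<length D. wedge_minor Z n (punctured ! c) (?u ! c))"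
      by (rule prod.remove[symmetric]) (use J in auto)
    finally show ?thesis
      unfolding m
      using corner_image_closed(3)[OF corner_imageI[of ?u], of "last ?v k"] len J b witness
      by (simp add: nth_list_update punctured_nth card_a)
  next
    case other': other
    have sub: "?b \<inter> {1..k + 1} \<subseteq> a" by (rule other[OF j(1) kb other'(2)])
    \<comment> \<open>The descent condition enters here: the boxes of this column above
      \<open>k\<close> are also boxes of the witnessing column.\<close>
    have above': "?l ! i' \<in> a - {k}" if "i' < i" for i'
    proof -
      have "?l ! i' \<in> ?b" using mem that j(2) by simp
      moreover from this have "?l ! i' \<ge> 1" using column_subset[OF j(1)] by auto
      ultimately show ?thesis using sub above[OF that] by auto
    qed
    let ?w = "vss ! J"
    have w: "length ?w = card a" using len(1)[OF J(1)] J(2) by simp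
    define R where "R = (\<Prod>c\<in>{..<length D} - {J} - {j}. W c)"
    \<comment> \<open>The filling after the exchange: vector \<open>p\<close> leaves column
      \<open>J\<close> and takes position \<open>l\<close> of column \<open>j\<close>. The displaced
      vector contributes its value under row \<open>k\<close>, a multiple of
      \<open>z_kk\<close>.\<close>
    define u where "u p l = vss[J := take p ?w @ drop (Suc p) ?w, j := ?v[l := ?w ! p]]" for p l
    have split: "(\<Prod>c<length D. f c) = f J * (f j * (\<Prod>c\<in>{..<length D} - {J} - {j}. f c))"
      for f :: "nat \<Rightarrow> 'k zpoly"
      by (subst prod.remove[of _ J], use J in simp, use J in simp, subst prod.remove[of _ j])
         (use j other' in auto)
    have prod_u: "wedge_minor Z n (a - {k}) (take p ?w @ drop (Suc p) ?w) * wedge_minor Z n ?b (?v[l := ?w ! p]) * R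
        = (\<Prod>c<length D. wedge_minor Z n (punctured ! c) (u p l ! c))" for p l
    proof -
      have "(\<Prod>c\<in>{..<length D} - {J} - {j}. wedge_minor Z n (punctured ! c) (u p l ! c)) = R"
        unfolding R_def by (rule prod.cong) (auto simp: W_def punctured_nth u_def)
      then show ?thesis
        unfolding split[of "\<lambda>c. wedge_minor Z n (punctured ! c) (u p l ! c)"]
        using J j len other' by (simp add: punctured_nth u_def mult.assoc)
    qed
    have len_u: "length (u p l ! c) = card (punctured ! c)" if "c < length D" "p < card a" for p l c
      using that len w other' J j by (auto simp: u_def nth_list_update punctured_nth card_a)
    have "(\<Prod>c<length D. W c) = W J * W j * R"
      unfolding split[of W] R_def by (simp only: mult.assoc)
    also have "W J * W j = (\<Sum>l\<in>{i..<card ?b}. \<Sum>p<card a. row_apply Z n k (?v ! l) * (-1) ^ (card a - 1 + p) *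
       (wedge_minor Z n (a - {k}) (take p ?w @ drop (Suc p) ?w) * wedge_minor Z n ?b (?v[l := ?w ! p])))"
      unfolding W_def J(2)
      by (rule wedge_minor_exchange[OF finite_a a w len(1)[OF j(1)] j(2) i above' zero])
    also have "\<dots> * R = (\<Sum>l\<in>{i..<card ?b}. \<Sum>p<card a. zconst ((?v ! l) k * (-1) ^ (card a - 1 + p)) *
       (\<zeta> * (\<Prod>c<length D. wedge_minor Z n (punctured ! c) (u p l ! c))))"
      unfolding sum_distrib_right
      by (intro sum.cong refl)
         (simp add: row_k[OF v'] prod_u[symmetric] zconst.hom_mult zconst.hom_power zconst.hom_uminus mult_ac)
    also have "\<dots> \<in> corner_image"
      by (intro corner_image_sum corner_image_closed(3) corner_imageI len_u) auto
    finally show ?thesis unfolding m .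
  qed
qed

text \<open>Generators give one inclusion. For the other, each tableau of the punctured diagram is
  completed by \<open>z_k\<close> at the end of column \<open>J\<close>, which yields a flag
  relation whose value is \<open>z_kk\<close> times the given product of minors.\<close>

lemma minors_map_flag_rels:
  "minors_map Z n D ` flag_rels n (bs_op k (std_flag n)) D = (corner_image :: 'k::comm_ring_1 zpoly set)"
proof
  have "x \<in> flag_rels n (bs_op k (std_flag n)) D \<Longrightarrow> minors_map Z n D x \<in> corner_image" for x :: "'k tens"
    unfolding flag_rels_def
  proof (induction rule: fscale.span_induct)
    case base
    show ?case
      unfolding fscale.subspace_def
      unfolding mem_Collect_eq minors_map_zero minors_map_add minors_map_scale Ball_def
      using corner_image_closed by blast
  next
    case (step x)
    then show ?case by (auto intro!: flag_generator_mem)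
  qed
  then show "minors_map Z n D ` flag_rels n (bs_op k (std_flag n)) D \<subseteq> (corner_image :: 'k zpoly set)" by blast
  show "corner_image \<subseteq> minors_map Z n D ` (flag_rels n (bs_op k (std_flag n)) D :: 'k tens set)"
  proof
    fix p :: "'k zpoly" assume "p \<in> corner_image"
    then obtain y where y: "y \<in> TE n punctured" "p = \<zeta> * minors_map Z n punctured y" by (auto simp: corner_image_def)
    define w :: "nat set list \<Rightarrow> 'k vec_E list list" where
      "w \<tau> = (map (\<lambda>b. map basis_vec (sorted_list_of_set b)) \<tau>)
        [J := map basis_vec (sorted_list_of_set (\<tau> ! J)) @ [basis_vec k]]" for \<tau>
    have len: "length (w \<tau> ! j) = card (D ! j)" if "\<tau> \<in> tableaux n punctured" "j < length D" for \<tau> j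
      using that tableauxD(1,3)[OF that(1)] J card_a
      by (auto simp: w_def nth_list_update length_punctured punctured_nth)
    have gen: "tensor_of_wedges n D (w \<tau>) \<in> flag_rels n (bs_op k (std_flag n)) D" if \<tau>: "\<tau> \<in> tableaux n punctured" for \<tau>
    proof -
      have l\<tau>: "length \<tau> = length D" using tableauxD(1)[OF \<tau>] length_punctured by simp
      have "set (w \<tau> ! j) \<subseteq> space_E n" if "j < length D" for j
      proof -
        have *: "\<tau> ! j \<subseteq> {1..n}" "finite (\<tau> ! j)" using tableauxD[OF \<tau>] that length_punctured by auto
        have "basis_vec q \<in> (space_E n :: 'k vec_E set)" if "q \<in> {1..n}" for q
          using that by (auto simp: space_E_def basis_vec_def)
        then show ?thesis
          using * that J k k_le_n l\<tau> by (auto simp: w_def nth_list_update)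
      qed
      \<comment> \<open>The last position of column \<open>J\<close> carries the box
        \<open>k\<close>, where the kernel of the flag is
        \<open>\<langle>z_k, \<dots>, z_n\<rangle>\<close>.\<close>
      moreover have "w \<tau> ! J ! l \<in> bs_op k (std_flag n) (sorted_list_of_set (D ! J) ! (card a - 1))"
        if "card a - 1 \<le> l" "l < card (D ! J)" for l
      proof -
        have "l = card a - 1" using that J by simp
        moreover have "length (sorted_list_of_set (\<tau> ! J)) = card a - 1"
          using tableauxD(3)[OF \<tau>, of J] J length_punctured card_a by (simp add: punctured_nth)
        ultimately have "w \<tau> ! J ! l = basis_vec k"
          using J l\<tau> by (simp add: w_def nth_append)
        moreover have "sorted_list_of_set (D ! J) ! (card a - 1) = k"
          using sorted_list_of_set_snoc[OF finite_a a] card_a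
          unfolding J(2) by (metis length_sorted_list_of_set nth_append_length)
        ultimately show ?thesis using k k_le_n by (simp add: bs_op_at basis_vec_mem_std_flag)
      qed
      ultimately show ?thesis
        unfolding flag_rels_def
        by (intro fscale.span_base CollectI exI[of _ "w \<tau>"] conjI refl allI impI exI[of _ J] exI[of _ "card a - 1"])
           (use len[OF \<tau>] J card_a l\<tau> in \<open>auto simp: w_def\<close>)
    qed
    have val: "minors_map Z n D (tensor_of_wedges n D (w \<tau>)) = \<zeta> * (\<Prod>j<length punctured. minor Z (punctured ! j) (\<tau> ! j))"
      if \<tau>: "\<tau> \<in> tableaux n punctured" for \<tau>
    proof -
      have l\<tau>: "length \<tau> = length D" using tableauxD(1)[OF \<tau>] length_punctured by simp
      have basis: "wedge_minor Z n (punctured ! j) (map basis_vec (sorted_list_of_set (\<tau> ! j))) = (minor Z (punctured ! j) (\<tau> ! j) :: 'k zpoly)"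
        if "j < length D" for j
      proof -
        have *: "\<tau> ! j \<subseteq> {1..n}" "card (\<tau> ! j) = card (punctured ! j)" using tableauxD[OF \<tau>] that length_punctured by auto
        have "minor (\<lambda>p q. row_apply Z n p (basis_vec q)) (punctured ! j) (\<tau> ! j) = (minor Z (punctured ! j) (\<tau> ! j) :: 'k zpoly)"
          by (rule minor_cong[OF _ *(2)]) (use *(1) row_apply_basis_vec in blast)
        then show ?thesis unfolding wedge_minor_map[OF *(2)] .
      qed
      have wJ: "w \<tau> ! J = map basis_vec (sorted_list_of_set (\<tau> ! J)) @ [basis_vec k]"
        using J l\<tau> by (simp add: w_def)
      have bk: "basis_vec k \<in> (std_flag n (k - 1) :: 'k vec_E set)"
        using k k_le_n by (simp add: basis_vec_mem_std_flag)
      have "wedge_minor Z n a (w \<tau> ! J) = row_apply Z n k (last (w \<tau> ! J)) * wedge_minor Z n (a - {k}) (butlast (w \<tau> ! J))"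
      proof (rule wedge_minor_last_column[OF finite_a a])
        show "length (w \<tau> ! J) = card a" using len[OF \<tau> J(1)] J(2) by simp
        fix p assume "p \<in> a" "p \<noteq> k"
        then show "row_apply Z n p (last (w \<tau> ! J)) = 0"
          using row_above[OF bk, of p] le_k[of p] wJ by simp
      qed
      \<comment> \<open>The coordinate of \<open>z_k\<close> at \<open>k\<close> is 1, so row
        \<open>k\<close> contributes exactly \<open>z_kk\<close>.\<close>
      also have "\<dots> = \<zeta> * minor Z (punctured ! J) (\<tau> ! J)"
        using basis[OF J(1)] J(1) row_k[OF bk] by (simp add: wJ punctured_nth) (simp add: basis_vec_def)
      finally have 1: "wedge_minor Z n (D ! J) (w \<tau> ! J) = \<zeta> * minor Z (punctured ! J) (\<tau> ! J)" unfolding J(2) .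
      have 2: "wedge_minor Z n (D ! j) (w \<tau> ! j) = minor Z (punctured ! j) (\<tau> ! j)" if "j < length D" "j \<noteq> J" for j
        using basis[OF that(1)] that l\<tau> by (simp add: w_def punctured_nth)
      have "minors_map Z n D (tensor_of_wedges n D (w \<tau>)) = (\<Prod>j<length D. wedge_minor Z n (D ! j) (w \<tau> ! j))"
        by (rule minors_map_tensor_of_wedges) (rule len[OF \<tau>])
      also have "\<dots> = (\<Prod>j<length D. (if j = J then \<zeta> else 1) * minor Z (punctured ! j) (\<tau> ! j))"
        by (rule prod.cong) (auto simp: 1 2)
      also have "\<dots> = \<zeta> * (\<Prod>j<length punctured. minor Z (punctured ! j) (\<tau> ! j))"
        using J(1) by (simp add: prod.distrib length_punctured)
      finally show ?thesis .
    qed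
    let ?x = "\<Sum>\<tau>\<in>tableaux n punctured. fscale (y \<tau>) (tensor_of_wedges n D (w \<tau>))"
    have "minors_map Z n D ?x = (\<Sum>\<tau>\<in>tableaux n punctured. zconst (y \<tau>) * (\<zeta> * (\<Prod>j<length punctured. minor Z (punctured ! j) (\<tau> ! j))))"
      unfolding minors_map_sum minors_map_scale by (rule sum.cong) (simp_all only: val)
    also have "\<dots> = p" unfolding y(2) by (simp add: minors_map_def sum_distrib_left mult_ac)
    finally have "p = minors_map Z n D ?x" ..
    moreover have "?x \<in> flag_rels n (bs_op k (std_flag n)) D"
      using gen unfolding flag_rels_def by (intro fscale.span_sum fscale.span_scale)
    ultimately show "p \<in> minors_map Z n D ` flag_rels n (bs_op k (std_flag n)) D" by (rule image_eqI)
  qed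
qed

end

lemma module_zconst: "Modules.module (\<lambda>c (p :: 'k::comm_ring_1 zpoly). zconst c * p)"
  by unfold_locales (simp_all add: zconst.hom_add zconst.hom_mult algebra_simps)

context descent
begin

section \<open>The swap of rows \<open>k\<close> and \<open>k + 1\<close>\<close>

definition swapped :: diagram where
  "swapped = map (\<lambda>c. Transposition.transpose k (k + 1) ` c) punctured"

lemma length_swapped: "length swapped = length D" by (simp add: swapped_def length_punctured)

text \<open>Tableaux depend only on the sizes of the columns, which a bijection of rows preserves.
  So the two diagrams have the same tensors and the same action, and only the relations need
  comparison.\<close>

lemma tableaux_swapped: "tableaux n swapped = tableaux n punctured"
proof -
  have "card (Transposition.transpose k (k + 1) ` c) = card c" for c :: "nat set"
    by (intro card_image inj_on_subset[OF inj_swap]) simp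
  then show ?thesis by (auto simp: tableaux_def swapped_def)
qed

lemma TE_swapped: "TE n swapped = TE n punctured"
  by (simp add: TE_def tableaux_swapped)

lemma act_TE_swapped: "act_TE n swapped = act_TE n punctured"
  by (intro ext) (simp only: act_TE_def tensor_of_wedges_def tableaux_swapped length_swapped length_punctured)

lemma stretched_matrix_swap:
  "subst (\<lambda>(p, q). Z (Transposition.transpose k (k + 1) p) q) (Z p q) = Z (Transposition.transpose k (k + 1) p) q"
proof -
  have "width k (Transposition.transpose k (k + 1) p) = width k p"
    using k by (auto simp: width_def Transposition.transpose_def)
  then show ?thesis by (auto simp: stretched_matrix_eq subst_zero subst_generic)
qed

text \<open>Up to one global sign, moving the boxes amounts to exchanging two rows of the matrix.
  These rows have equal width, so this is an exchange of variables, an involution that preserves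
  vanishing.\<close>

lemma minors_map_swapped_eq_0_iff:
  fixes x :: "'k::comm_ring_1 tens"
  shows "minors_map Z n swapped x = 0 \<longleftrightarrow> minors_map Z n punctured x = 0"
proof -
  let ?s = "Transposition.transpose k (k + 1)"
  let ?Zs = "\<lambda>p. Z (?s p) :: nat \<Rightarrow> 'k zpoly"
  let ?\<sigma> = "subst (\<lambda>(p, q). ?Zs p q)"
  \<comment> \<open>Of each sign only \<open>e * e = 1\<close> is kept, enough to cancel it by
    multiplying again.\<close>
  have "\<forall>j\<in>{..<length punctured}. \<exists>e. e * e = 1 \<and> (\<forall>b. card b = card (punctured ! j) \<longrightarrow> minor Z (swapped ! j) b = e * minor ?Zs (punctured ! j) b)"
  proof
    fix j assume j: "j \<in> {..<length punctured}"
    have "finite (punctured ! j)" using finite_column_punctured j length_punctured by simp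
    then obtain e :: "'k zpoly" where e: "e \<in> {1, -1}"
      "\<forall>Z b. minor Z (?s ` (punctured ! j)) b = e * minor (\<lambda>p. Z (?s p)) (punctured ! j) b"
      by (rule minor_swap_rows[THEN bexE])
    then show "\<exists>e. e * e = 1 \<and> (\<forall>b. card b = card (punctured ! j) \<longrightarrow> minor Z (swapped ! j) b = e * minor ?Zs (punctured ! j) b)"
      using j by (intro exI[of _ e]) (auto simp: swapped_def)
  qed
  then obtain e where e: "\<And>j. j < length punctured \<Longrightarrow> e j * e j = 1"
    "\<And>j b. j < length punctured \<Longrightarrow> card b = card (punctured ! j) \<Longrightarrow> minor Z (swapped ! j) b = e j * minor ?Zs (punctured ! j) b"
    unfolding bchoice_iff by auto
  define u where "u = (\<Prod>j<length punctured. e j)"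
  have u: "u * u = 1" unfolding u_def prod.distrib[symmetric] by (rule prod.neutral) (auto simp: e(1))
  have "minors_map Z n swapped x = (\<Sum>\<tau>\<in>tableaux n punctured. zconst (x \<tau>) * (\<Prod>j<length punctured. e j * minor ?Zs (punctured ! j) (\<tau> ! j)))"
    unfolding minors_map_def tableaux_swapped length_swapped length_punctured[symmetric]
    by (intro sum.cong prod.cong refl arg_cong2[of _ _ _ _ "(*)"] e(2)) (auto simp: tableauxD)
  also have "\<dots> = u * minors_map ?Zs n punctured x"
    by (simp add: minors_map_def u_def prod.distrib sum_distrib_left mult_ac)
  finally have 1: "minors_map Z n swapped x = u * minors_map ?Zs n punctured x" .
  have 2: "minors_map ?Zs n punctured x = ?\<sigma> (minors_map Z n punctured x)"
    by (subst minors_map_hom[OF comm_ring_hom_subst subst_zconst]) (simp only: stretched_matrix_swap)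
  have 3: "minors_map Z n punctured x = ?\<sigma> (minors_map ?Zs n punctured x)"
    by (subst minors_map_hom[OF comm_ring_hom_subst subst_zconst])
       (simp only: stretched_matrix_swap transpose_involutory)
  have "minors_map Z n swapped x = 0 \<longleftrightarrow> minors_map ?Zs n punctured x = 0"
  proof
    assume "minors_map Z n swapped x = 0"
    with 1 have "u * (u * minors_map ?Zs n punctured x) = 0" by simp
    then show "minors_map ?Zs n punctured x = 0" unfolding mult.assoc[symmetric] u by simp
  qed (simp add: 1)
  also have "\<dots> \<longleftrightarrow> minors_map Z n punctured x = 0"
  proof
    assume "minors_map ?Zs n punctured x = 0"
    then show "minors_map Z n punctured x = 0" by (subst 3) (simp only: subst_zero)
  next
    assume "minors_map Z n punctured x = 0"
    then show "minors_map ?Zs n punctured x = 0" by (subst 2) (simp only: subst_zero)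
  qed
  finally show ?thesis .
qed

section \<open>The line \<open>K_k\<close>\<close>

text \<open>The coordinate at \<open>k\<close> identifies \<open>\<langle>z_k, \<dots>, z_n\<rangle>
  / \<langle>z_{k+1}, \<dots>, z_n\<rangle>\<close> with the ring. A lower triangular
  \<open>g\<close> acts on it by its diagonal entry.\<close>

lemma quot_by_map_line:
  "quot_by_map (lower_triangular n) (apply_E n) (std_flag n (k - 1)) (std_flag n k :: 'k::comm_ring_1 vec_E set)
    (*) (\<lambda>g c. g k k * c) (\<lambda>v. v k)"
proof
  show "fscale.subspace (std_flag n (k - 1) :: 'k vec_E set)" by (rule subspace_std_flag)
  show "std_flag n k = {v \<in> std_flag n (k - 1). v k = (0 :: 'k)}"
  proof -
    have "i \<notin> {k + 1..n} \<longleftrightarrow> i \<notin> {k - 1 + 1..n} \<or> i = k" for i using k k_le_n by auto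
    then show ?thesis unfolding std_flag_eq by auto
  qed
  fix g :: "nat \<Rightarrow> nat \<Rightarrow> 'k" and v :: "'k vec_E"
  assume g: "g \<in> lower_triangular n" and v: "v \<in> std_flag n (k - 1)"
  have g0: "g i j = 0" if "i < j \<or> i \<notin> {1..n} \<or> j \<notin> {1..n}" for i j
    using g that unfolding lower_triangular_def GL_E_def by blast
  have v0: "v i = 0" if "i < k" for i using v that k by (auto simp: std_flag_eq)
  show "apply_E n g v k = g k k * v k"
  proof -
    have "(\<Sum>j\<in>{1..n}. g k j * v j) = (\<Sum>j\<in>{1..n}. if j = k then g k k * v k else 0)"
    proof (rule sum.cong[OF refl])
      fix j
      show "g k j * v j = (if j = k then g k k * v k else 0)"
        using g0[of k j] v0[of j] by (cases j k rule: linorder_cases) auto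
    qed
    then show ?thesis using k k_le_n by (simp add: apply_E_def)
  qed
  have "apply_E n g v i = 0" if i: "i \<notin> {k - 1 + 1..n}" for i
    unfolding apply_E_def
  proof (rule sum.neutral, rule ballI)
    fix j
    show "g i j * v j = 0"
      using g0[of i j] v0[of j] i k by (cases "j < k") auto
  qed
  then show "apply_E n g v \<in> std_flag n (k - 1)" unfolding std_flag_eq by blast
qed (simp_all add: fscale_def)

section \<open>The isomorphism of \<open>B\<close>-modules\<close>

text \<open>Both sides are realised on \<open>corner_image\<close> with the action
  \<open>col_action\<close>: the kernel by products of minors for \<open>D\<close>, the tensor
  product by \<open>z_kk\<close> times products of minors for the punctured diagram.\<close>

lemma kernel_iso_tensor:
  assumes emb: "embeds_in_polys n (stretched_flag n k :: 'k::comm_ring_1 flag) D"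
    and emb': "embeds_in_polys n (stretched_flag n k :: 'k flag) swapped"
  shows "rep_iso (lower_triangular n :: (nat \<Rightarrow> nat \<Rightarrow> 'k) set)
     (schur_ker n (stretched_flag n k) (bs_op k (std_flag n)) D)
     (tensor_rep (flag_ker n (stretched_flag n k) (bs_op k (std_flag n)) k)
                 (schur_module n (stretched_flag n k) swapped))"
proof -
  let ?G = "lower_triangular n :: (nat \<Rightarrow> nat \<Rightarrow> 'k) set"
  let ?s = "\<lambda>c (p :: 'k zpoly). zconst c * p"
  let ?\<theta> = "col_action n k :: (nat \<Rightarrow> nat \<Rightarrow> 'k) \<Rightarrow> 'k zpoly \<Rightarrow> 'k zpoly"
  let ?F = "stretched_flag n k :: 'k flag"
  let ?F' = "bs_op k (std_flag n) :: 'k flag"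
  let ?\<zeta> = "\<zeta> :: 'k zpoly"

  let ?K = "quot_rep (apply_E n) (std_flag n (k - 1)) (std_flag n k :: 'k vec_E set)"
  interpret K: quot_by_map ?G "apply_E n" "std_flag n (k - 1)" "std_flag n k" "(*)" "\<lambda>g c. g k k * c" "\<lambda>v. v k"
    by (rule quot_by_map_line)
  have K: "flag_ker n ?F ?F' k = ?K"
    unfolding flag_ker_def stretched_flag_eq bs_op_at width_def
    by (simp only: order_refl if_True,
        rule ker_quot_map_eq[OF subspace_std_flag std_flag_antimono std_flag_subset
          fscale.subspace_0[OF subspace_std_flag]]) simp
  have "(\<lambda>v. v k) ` std_flag n (k - 1) = (UNIV :: 'k set)"
  proof -
    have "c \<in> (\<lambda>v. v k) ` std_flag n (k - 1)" for c :: 'k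
      by (rule image_eqI[of _ _ "\<lambda>i. if i = k then c else 0"]) (use k k_le_n in \<open>auto simp: std_flag_eq\<close>)
    then show ?thesis by blast
  qed
  then have range_K: "K.val ` elems ?K = UNIV" by (simp only: K.val_image)

  let ?N = "{x \<in> TE n punctured. minors_map Z n punctured x = (0 :: 'k zpoly)}"
  let ?S = "quot_rep (act_TE n punctured) (TE n punctured) ?N"
  interpret S: quot_by_map ?G "act_TE n punctured" "TE n punctured" ?N ?s ?\<theta> "minors_map Z n punctured"
    by unfold_locales
       (simp_all only: subspace_TE minors_map_add minors_map_scale act_TE_mem minors_map_act)
  have S: "schur_module n ?F swapped = ?S"
    unfolding schur_module_def schur_rels_eq_kernel[OF emb'] minors_map_swapped_eq_0_iff TE_swapped act_TE_swapped ..

  interpret P: Modules.module ?s by (rule module_zconst)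
  interpret T: rank_one_tensor ?s ?G ?K ?S "\<lambda>g. g k k" ?\<theta> K.val S.val
  proof
    show "realizes ?G ?K (*) (\<lambda>g c. g k k * c) K.val" by (rule K.realizes_quot)
    show "realizes ?G ?S ?s ?\<theta> S.val" by (rule S.realizes_quot)
    show "elems ?S \<noteq> {}" using fscale.subspace_0[OF subspace_TE, of n punctured] by (auto simp: quot_rep_def)
  qed (simp_all only: range_K col_action_add col_action_scale)

  let ?V = "schur_rels n ?F' D"
  have FF': "?F p \<subseteq> ?F' p" for p
  proof (cases "p = k")
    case True
    then show ?thesis
      using std_flag_antimono[of "k - 1" k n] by (simp only: stretched_flag_eq bs_op_at width_def order_refl if_True) simp
  next
    case False
    then show ?thesis by (rule equalityD2[OF bs_op_eq_stretched])
  qed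
  have V: "fscale.subspace ?V" "?V \<subseteq> TE n D" "schur_rels n ?F D \<subseteq> ?V"
    by (rule subspace_schur_rels, rule schur_rels_subset, rule schur_rels_mono[OF FF'])
  \<comment> \<open>Exchange relations have value 0, so only the flag relations of the smaller flag
    contribute.\<close>
  have image_V: "minors_map Z n D ` ?V = (corner_image :: 'k zpoly set)"
  proof -
    have "minors_map Z n D (x + y) = minors_map Z n D x" if "y \<in> exchange_rels n D" for x y :: "'k tens"
      using minors_map_exchange_rels[OF that, of "?F"] by (simp only: minors_map_add stretched_matrix_def add_0_right)
    moreover have "(0 :: 'k tens) \<in> exchange_rels n D" by (rule fscale.subspace_0[OF subspace_exchange_rels])
    ultimately have "minors_map Z n D ` ?V = minors_map Z n D ` flag_rels n ?F' D"
      unfolding schur_rels_def set_plus_def image_def by (fastforce simp del: zero_fun_def plus_fun_def)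
    then show ?thesis unfolding minors_map_flag_rels .
  qed
  have kernel: "schur_rels n ?F D = {x \<in> ?V. minors_map Z n D x = 0}"
    using V(2,3) schur_rels_eq_kernel[OF emb] by blast
  have \<theta>_corner: "?\<theta> g (?\<zeta> * p) = ?\<zeta> * (zconst (g k k) * ?\<theta> g p)" if "g \<in> ?G" for g p
    unfolding col_action_mult col_action_corner[OF that k k_le_n] by (simp only: mult_ac)
  interpret L: quot_by_map ?G "act_TE n D" ?V "schur_rels n ?F D" ?s ?\<theta> "minors_map Z n D"
  proof
    \<comment> \<open>Stability is seen in polynomials: \<open>corner_image\<close> is stable
      because \<open>z_kk\<close> is an eigenvector, so the image of \<open>v\<close> under
      \<open>g\<close> differs from an element of \<open>?V\<close> by one of the kernel, which lies
      in \<open>?V\<close>.\<close>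
    show "act_TE n D g v \<in> ?V" if g: "g \<in> ?G" and v: "v \<in> ?V" for g v
    proof -
      have "minors_map Z n D v \<in> corner_image" unfolding image_V[symmetric] using v by (rule imageI)
      then obtain y where y: "minors_map Z n D v = ?\<zeta> * minors_map Z n punctured y" "y \<in> TE n punctured"
        by (auto simp: corner_image_def)
      have "minors_map Z n D (act_TE n D g v)
          = ?\<zeta> * minors_map Z n punctured (fscale (g k k) (act_TE n punctured g y))"
        unfolding minors_map_act[OF g] minors_map_scale y(1) \<theta>_corner[OF g] ..
      also have "\<dots> \<in> minors_map Z n D ` ?V"
        unfolding image_V corner_image_def
        by (intro imageI fscale.subspace_scale[OF subspace_TE] act_TE_mem)
      finally obtain w where w: "w \<in> ?V" "minors_map Z n D (act_TE n D g v) = minors_map Z n D w" by blast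
      have wT: "w \<in> TE n D" using w V by blast
      have "minors_map Z n D (act_TE n D g v - w) + minors_map Z n D w = minors_map Z n D (act_TE n D g v)"
        unfolding minors_map_add[symmetric] by (simp only: diff_add_cancel)
      then have "minors_map Z n D (act_TE n D g v - w) = 0" using w(2) by (simp only: add_cancel_left_left)
      then have "act_TE n D g v - w \<in> schur_rels n ?F D"
        unfolding schur_rels_eq_kernel[OF emb]
        using fscale.subspace_diff[OF subspace_TE act_TE_mem wT] by blast
      then have "(act_TE n D g v - w) + w \<in> ?V"
        using V(3) w(1) by (intro fscale.subspace_add[OF V(1)]) blast+
      then show ?thesis by (simp only: diff_add_cancel)
    qed
  qed (simp_all only: V(1) kernel minors_map_add minors_map_scale minors_map_act)
  have L: "schur_ker n ?F ?F' D = quot_rep (act_TE n D) ?V (schur_rels n ?F D)"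
    unfolding schur_ker_def
    by (rule ker_quot_map_eq[OF V(1,3,2) fscale.subspace_0[OF subspace_schur_rels]])

  have inj: "inj (\<lambda>p. ?\<zeta> * p)"
  proof (rule injI)
    fix p q assume "?\<zeta> * p = ?\<zeta> * q"
    then have "?\<zeta> * (p - q) = 0" by (simp add: right_diff_distrib)
    then have "p - q = 0" by (rule generic_mult_cancel)
    then show "p = q" by simp
  qed
  \<comment> \<open>Multiplication by \<open>z_kk\<close> absorbs the twist: on multiples of
    \<open>z_kk\<close> the plain action reproduces the character of \<open>K_k\<close>.\<close>
  have "realizes ?G (tensor_rep ?K ?S) ?s ?\<theta> ((\<lambda>p. ?\<zeta> * p) \<circ> T.tensor.val)"
    by (rule realizes_comp[OF T.realizes_tensor inj])
       (simp_all only: distrib_left mult.left_commute \<theta>_corner)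
  moreover have "L.val ` elems (quot_rep (act_TE n D) ?V (schur_rels n ?F D))
      = ((\<lambda>p. ?\<zeta> * p) \<circ> T.tensor.val) ` elems (tensor_rep ?K ?S)"
    unfolding L.val_image image_V image_comp[symmetric] T.tensor_val_image S.val_image corner_image_def
    by (simp only: image_image)
  ultimately show ?thesis
    unfolding K S L by (rule rep_iso_if_same_realization[OF L.realizes_quot])
qed

end

section \<open>Passing from the descent to its witnessing column\<close>

text \<open>Uniqueness of the witness lets the description in \<open>descent_op\<close> be
  evaluated. The reordering is used only to see on which side of the witness another column
  stands.\<close>

lemma descentI:
  assumes k: "1 \<le> k" and desc: "has_descent k D" and rows: "in_rows n D"
  obtains a J where "descent n k D a J"
    "descent_op k D = map (\<lambda>c. Transposition.transpose k (k + 1) ` c) (D[J := a - {k}])"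
proof -
  obtain a where a: "descent_witness k D a" using desc by (auto simp: has_descent_def)
  have the_a: "(THE a. descent_witness k D a) = a"
    by (rule the_equality, rule a) (rule descent_witness_unique[OF rows _ a])
  obtain D' j where D': "mset D' = mset D" "j < length D'" "D' ! j = a" "a \<noteq> {}" "Max a = k"
      "\<forall>j'<j. full_at k (D' ! j')"
      "\<forall>j'. j < j' \<and> j' < length D' \<longrightarrow> D' ! j' \<inter> {1..k + 1} \<subseteq> a"
    using a unfolding descent_witness_def by blast
  have sets: "set D' = set D" using D'(1) by (rule mset_eq_setD)
  have aD: "a \<in> set D" using D'(2,3) sets nth_mem by metis
  have an: "a \<subseteq> {1..n}" using aD rows by (auto simp: in_rows_def)
  have fina: "finite a" using an finite_subset by blast
  define J where "J = (LEAST j. j < length D \<and> D ! j = a)"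
  have "\<exists>j. j < length D \<and> D ! j = a" using aD by (auto simp: in_set_conv_nth)
  from LeastI_ex[OF this] have J: "J < length D" "D ! J = a" unfolding J_def by blast+
  have "descent n k D a J"
  proof
    fix i assume i: "i < length D" "k \<in> D ! i" "k + 1 \<notin> D ! i"
    then have "D ! i \<in> set D'" unfolding sets by simp
    then obtain i' where i': "i' < length D'" "D' ! i' = D ! i" by (auto simp: in_set_conv_nth)
    \<comment> \<open>Columns before the witness are \<open>k\<close>-full, and this one is
      not.\<close>
    have "\<not> i' < j" using D'(6) i i' by (auto simp: full_at_def)
    then consider "i' = j" | "j < i'" by linarith
    then show "D ! i \<inter> {1..k + 1} \<subseteq> a"
    proof cases
      case 1 then show ?thesis using D'(3) i' by auto
    next
      case 2 then show ?thesis using D'(7) i' by metis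
    qed
  qed (use k rows J D'(4,5) in auto)
  moreover have "descent_op k D = map (\<lambda>c. Transposition.transpose k (k + 1) ` c) (D[J := a - {k}])"
    unfolding descent_op_def the_a J_def Let_def ..
  ultimately show thesis by (rule that)
qed

theorem lemma4p10:
  fixes n k :: nat and D :: diagram and E :: "'k::comm_ring_1 flag"
  assumes "k \<ge> 1"
    and "E = std_flag n"
    and "has_descent k D"
    and "in_rows n D" and "in_rows n (descent_op k D)"
    and "embeds_in_polys n (bs_op (k + 1) E) D"
    and "embeds_in_polys n (bs_op (k + 1) E) (descent_op k D)"
  shows "rep_iso (lower_triangular n)
     (schur_ker n (bs_op (k + 1) E) (bs_op k E) D)
     (tensor_rep (flag_ker n (bs_op (k + 1) E) (bs_op k E) k)
                 (schur_module n (bs_op (k + 1) E) (descent_op k D)))"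
proof -
  obtain a J where "descent n k D a J"
    and op: "descent_op k D = map (\<lambda>c. Transposition.transpose k (k + 1) ` c) (D[J := a - {k}])"
    using descentI[OF assms(1,3,4)] .
  then interpret descent n k D a J by simp
  have F: "bs_op (k + 1) E = stretched_flag n k" by (simp only: assms(2) stretched_flag_def)
  have op': "descent_op k D = swapped" unfolding op swapped_def punctured_def ..
  show ?thesis
    using assms(6,7) unfolding F op' unfolding assms(2) by (rule kernel_iso_tensor)
qed

end
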